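(* Let $f:[1,\infty)\to(0,\infty)$ be a nondecreasing function. (1) Let $0<\lambda\le\infty$. Then, with probability one, $$\limsup_{n\to\infty}\frac{|S_n|}{B_n (f(n))^{1/\alpha_1}}=0 \iff \int_1^\infty \frac{dx}{x f(x)}<\infty,\qquad \limsup_{n\to\infty}\frac{|S_n|}{B_n (f(n))^{1/\alpha_1}}=\infty \iff \int_1^\infty \frac{dx}{x f(x)}=\infty .$$ (2) Let $\lambda=0$ (i.e. the limit distribution of the normalized $S_n$ is the stable $(\alpha_2)$ law), and assume that for some $\mu>\frac{\alpha_2-\alpha_1}{\alpha_2}$ one has $\tau_1(n)<n^{\alpha_1/\alpha_2}(\log n)^{-\mu}$ for all sufficiently large $n$. Then, with probability one, $$\limsup_{n\to\infty}\frac{|S_n|}{B_n (f(n))^{1/\alpha_2}}=0 \iff \int_1^\infty \frac{dx}{x f(x)}<\infty,\qquad \limsup_{n\to\infty}\frac{|S_n|}{B_n (f(n))^{1/\alpha_2}}=\infty \iff \int_1^\infty \frac{dx}{x f(x)}=\infty .$$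
   Context: Let $0<\alpha_1<\alpha_2<2$. $\{X_n\}_{n\ge1}$ are independent random variables; $X_n$ has distribution function $F_n\in\{G_1,G_2\}$. For $j=1,2$, $G_j$ is in the domain of normal attraction of the (symmetric, non-normal) stable law with characteristic function $\varphi_j(t)=\exp(-\lambda_j|t|^{\alpha_j})$, $\lambda_j>0$, called the stable $(\alpha_j)$ law; in particular, for $x>0$, $1-G_j(x)=\frac{c_{j1}+\theta_j(x)}{x^{\alpha_j}}$ and $G_j(-x)=\frac{c_{j2}+\beta_j(-x)}{x^{\alpha_j}}$ with $c_{j1},c_{j2}>0$ and $\theta_j(x),\beta_j(-x)\to0$ as $x\to\infty$. $S_n=\sum_{k=1}^n X_k$. $\tau_j(n)$ is the number of $k\le n$ with $F_k=G_j$, so $\tau_1(n)+\tau_2(n)=n$; it is assumed that $\tau_j(n)\to\infty$ for $j=1,2$. Let $U_{\tau_1(n)}$ and $V_{\tau_2(n)}$ be the sums of those $X_k$, $k\le n$, with distribution function $G_1$ and $G_2$ respectively. With $B_j(m)=m^{1/\alpha_j}$, $(U_{\tau_1(n)}-d_1(\tau_1(n)))/B_1(\tau_1(n))$ and $(V_{\tau_2(n)}-d_2(\tau_2(n)))/B_2(\tau_2(n))$ converge in distribution to the stable $(\alpha_1)$ and stable $(\alpha_2)$ laws; the centering convention is that $d_1=d_2=0$ if $\alpha_1\ne1,\alpha_2\neq 1$, while $d_j(n)\sim n\log n$ if $\alpha_j=1$ (here $f_n\sim g_n$ means that $f_n/g_n$ converges to a constant in $(0,\infty)$). It is assumed that $(S_n-A_n)/B_n$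 converges in distribution to a proper random variable for suitable $A_n\in\mathbb{R}$, $B_n>0$; equivalently $\frac{(\tau_1(n))^{\alpha_2}}{(\tau_2(n))^{\alpha_1}}\to\lambda$ for some $\lambda\in[0,\infty]$. The limit law is stable $(\alpha_2)$ if $\lambda=0$, a composition (convolution) of the two stable laws if $0<\lambda<\infty$, and stable $(\alpha_1)$ if $\lambda=\infty$. The normalization is $B_n=(\tau_1(n))^{1/\alpha_1}$ if $\lambda=\infty$ and $B_n=(\tau_2(n))^{1/\alpha_2}$ (of exact order $n^{1/\alpha_2}$) if $0\le\lambda<\infty$. *)

theory Defs
  imports "HOL-Probability.Probability"
begin

definition stable_law :: "real \<Rightarrow> real \<Rightarrow> real measure \<Rightarrow> bool" where
  "stable_law \<alpha> c L \<longleftrightarrow> real_distribution L \<and>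
     (\<forall>t. char L t = complex_of_real (exp (- c * \<bar>t\<bar> powr \<alpha>)))"

definition converges_to_stable :: "real \<Rightarrow> real \<Rightarrow> (nat \<Rightarrow> real measure) \<Rightarrow> bool" where
  "converges_to_stable \<alpha> c \<mu> \<longleftrightarrow> (\<exists>L. stable_law \<alpha> c L \<and> weak_conv_m \<mu> L)"

text \<open>The law of \<open>(Z\<^sub>1 + \<dots> + Z\<^sub>m - d) / b\<close> for independent \<open>Z\<^sub>i\<close> with distribution function \<open>G\<close>,
  realised on the \<open>m\<close>-fold product of the Lebesgue-Stieltjes measure of \<open>G\<close>.\<close>
definition iid_sum_law :: "(real \<Rightarrow> real) \<Rightarrow> nat \<Rightarrow> real \<Rightarrow> real \<Rightarrow> real measure" where
  "iid_sum_law G m d b =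
     distr (Pi\<^sub>M {..<m} (\<lambda>_. interval_measure G)) borel (\<lambda>z. ((\<Sum>i<m. z i) - d) / b)"

definition domain_normal_attraction :: "(real \<Rightarrow> real) \<Rightarrow> real \<Rightarrow> real \<Rightarrow> bool" where
  "domain_normal_attraction G \<alpha> c \<longleftrightarrow>
     (\<exists>a>0. \<exists>d. converges_to_stable \<alpha> c
        (\<lambda>m. iid_sum_law G m (d m) (a * real m powr (1 / \<alpha>))))"

definition stable_tails :: "(real \<Rightarrow> real) \<Rightarrow> real \<Rightarrow> bool" where
  "stable_tails G \<alpha> \<longleftrightarrow>
     (\<exists>c1>0. \<exists>c2>0. \<exists>\<theta> \<beta>.
        (\<forall>x>0. 1 - G x = (c1 + \<theta> x) / x powr \<alpha> \<and> G (- x) = (c2 + \<beta> (- x)) / x powr \<alpha>) \<and>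
        (\<theta> \<longlongrightarrow> 0) at_top \<and> ((\<lambda>x. \<beta> (- x)) \<longlongrightarrow> 0) at_top)"

text \<open>For \<open>\<alpha> = 1\<close> the constant \<open>K\<close> may be \<open>0\<close>: with a symmetric Cauchy limit every admissible
  centering is \<open>o(m log m)\<close>, so requiring \<open>K > 0\<close> would make this case vacuous.\<close>
definition centering_convention :: "real \<Rightarrow> (nat \<Rightarrow> real) \<Rightarrow> bool" where
  "centering_convention \<alpha> d \<longleftrightarrow>
     (\<alpha> \<noteq> 1 \<longrightarrow> (\<forall>m. d m = 0)) \<and>
     (\<alpha> = 1 \<longrightarrow> (\<exists>K\<ge>0. (\<lambda>m. d m / (real m * ln (real m))) \<longlonglongrightarrow> K))"

text \<open>Here \<open>F k\<close> is the distribution function of \<open>X k\<close>; the sequences are indexed from \<open>1\<close>, so the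
  values at \<open>0\<close> play no role.\<close>
definition class_indices :: "(nat \<Rightarrow> real \<Rightarrow> real) \<Rightarrow> (real \<Rightarrow> real) \<Rightarrow> nat \<Rightarrow> nat set" where
  "class_indices F G n = {k \<in> {1..n}. F k = G}"

definition tau :: "(nat \<Rightarrow> real \<Rightarrow> real) \<Rightarrow> (real \<Rightarrow> real) \<Rightarrow> nat \<Rightarrow> nat" where
  "tau F G n = card (class_indices F G n)"

definition class_sum ::
  "(nat \<Rightarrow> real \<Rightarrow> real) \<Rightarrow> (real \<Rightarrow> real) \<Rightarrow> (nat \<Rightarrow> 'a \<Rightarrow> real) \<Rightarrow> nat \<Rightarrow> 'a \<Rightarrow> real" where
  "class_sum F G X n \<omega> = (\<Sum>k\<in>class_indices F G n. X k \<omega>)"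

definition partial_sum :: "(nat \<Rightarrow> 'a \<Rightarrow> real) \<Rightarrow> nat \<Rightarrow> 'a \<Rightarrow> real" where
  "partial_sum X n \<omega> = (\<Sum>k=1..n. X k \<omega>)"

text \<open>Without nondegeneracy of the limit this would hold for every \<open>X\<close>, by letting
  \<open>B n\<close> grow fast.\<close>
definition has_proper_limit :: "'a measure \<Rightarrow> (nat \<Rightarrow> 'a \<Rightarrow> real) \<Rightarrow> bool" where
  "has_proper_limit M X \<longleftrightarrow>
     (\<exists>A B L. (\<forall>n. B n > 0) \<and> real_distribution L \<and> (\<forall>a. measure L {a} < 1) \<and>
        weak_conv_m (\<lambda>n. distr M borel (\<lambda>\<omega>. (partial_sum X n \<omega> - A n) / B n)) L)"

definition normalizer ::
  "real \<Rightarrow> real \<Rightarrow> ennreal \<Rightarrow> (nat \<Rightarrow> nat) \<Rightarrow> (nat \<Rightarrow> nat) \<Rightarrow> nat \<Rightarrow> real" where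
  "normalizer \<alpha>1 \<alpha>2 \<Lambda> \<tau>1 \<tau>2 n =
     (if \<Lambda> = \<infinity> then real (\<tau>1 n) powr (1 / \<alpha>1) else real (\<tau>2 n) powr (1 / \<alpha>2))"

end

theory Submission
  imports Defs "HOL-Real_Asymp.Real_Asymp"
begin

text \<open>
  Let \<open>T\<close> be the set of indices of one of the two classes, let \<open>cnt T n\<close> count its members up to
  \<open>n\<close>, and put \<open>a n = (cnt T n * g n) powr (1 / \<alpha>)\<close> with \<open>g\<close> nondecreasing. A tail of exact order
  \<open>x powr - \<alpha>\<close> makes the probability that \<open>\<bar>X k\<bar>\<close> exceeds a multiple of \<open>a k\<close> comparable to
  \<open>1 / (cnt T k * g k)\<close>. The series of these weights over \<open>T\<close> decides everything.

  If it converges, the class sum is \<open>o(a n)\<close> almost surely (\<open>class_sum_negligible\<close>). Truncate \<open>X k\<close>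
  at \<open>a k\<close>: only finitely many terms change. Because \<open>\<alpha> < 2\<close>, the variance of the truncated
  variable divided by \<open>(a k)\<^sup>2\<close> is bounded by a constant times the same weight, so Kolmogorov's criterion and
  Kronecker's lemma dispose of the centred truncated variables. The truncated means remain. They contribute
  \<open>o(a n)\<close> for \<open>\<alpha> < 1\<close> by size alone, and for \<open>\<alpha> > 1\<close> because the full mean is \<open>0\<close>, so that a
  truncated mean is minus a tail integral; the mean vanishes since the sums converge in law without
  centering (\<open>mean_zero_if_weakly_convergent\<close>). For \<open>\<alpha> = 1\<close> truncated means grow only
  logarithmically, and convergence of the series forces \<open>ln (cnt T n) = o(g n)\<close>.

  If it diverges, jumps exceeding any multiple of \<open>a k\<close> recur by the second Borel-Cantelli lemma. A
  jump is the difference of two consecutive sums of the whole sequence, so one of these two is large,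
  whatever the other class does (\<open>limsup_partial_sums_infinite\<close>).

  The integral of \<open>1 / (x * f x)\<close> is finite iff the sum of \<open>1 / (k * f k)\<close> is. This sum
  dominates the class series because \<open>cnt T k \<le> k\<close>. Conversely its divergence passes to a class
  with \<open>cnt T n \<ge> c * n powr p\<close>, by partial summation: then the harmonic number of \<open>cnt T n\<close> is at
  least \<open>p\<close> times that of \<open>n\<close>, up to a constant. If \<open>\<Lambda> > 0\<close> the first class has
  this property with \<open>p = \<alpha>1 / \<alpha>2\<close>; under the sparsity hypothesis of the second part the second class
  eventually makes up at least half of all indices.

  What remains is to compare \<open>B n\<close> times the power of \<open>f n\<close> with the normalizations of the two
  classes. Only the first class in the second part is not immediate. There one takes
  \<open>g n = (1 + ln n) powr (\<mu> + \<alpha>1 / \<alpha>2)\<close>: the exponent is greater than \<open>1\<close> precisely by the hypothesis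
  on \<open>\<mu>\<close>, so the series converges, and the powers of the logarithm are absorbed by the
  sparsity of the class and by \<open>ln n \<le> f n\<close>, which holds for large \<open>n\<close> when the integral is finite.
\<close>

section \<open>Summation by parts\<close>

text \<open>Partial summation transfers a comparison of the partial sums of two weights to sums against a
  nonincreasing \<open>g\<close>. It is what makes sparse classes with irregular gaps tractable: only the growth of
  their counting function matters.\<close>

lemma weighted_sum_le_by_parts:
  fixes w v g :: "nat \<Rightarrow> real"
  assumes le: "\<And>N. (\<Sum>k=1..N. w k) \<le> (\<Sum>k=1..N. v k) + C"
    and g: "antimono g" "\<And>n. 0 \<le> g n"
  shows "(\<Sum>k=1..N. w k * g k) \<le> (\<Sum>k=1..N. v k * g k) + C * g 1"
proof -
  let ?D = "\<lambda>N. (\<Sum>k=1..N. w k) - (\<Sum>k=1..N. v k)"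
  have C: "0 \<le> C" using le[of 0] by simp
  have main: "(\<Sum>k=1..N. w k * g k) - (\<Sum>k=1..N. v k * g k) \<le> ?D N * g N + C * (g 1 - g N)" if "N \<ge> 1" for N
    using that
  proof (induction N rule: nat_induct_at_least)
    case base
    then show ?case by (simp add: algebra_simps)
  next
    case (Suc N)
    have "?D N * (g N - g (Suc N)) \<le> C * (g N - g (Suc N))"
      using le[of N] antimonoD[OF g(1), of N "Suc N"] by (intro mult_right_mono) auto
    then show ?case using Suc by (simp add: algebra_simps)
  qed
  have "?D N * g N \<le> C * g N" using le[of N] g(2)[of N] by (intro mult_right_mono) auto
  then show ?thesis
    using main[of N] C g(2)[of 1] by (cases "1 \<le> N") (auto simp: algebra_simps)
qed

text \<open>Kronecker's lemma: partial summation bounds a block of the weighted sum by \<open>b n\<close> times twice the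
  oscillation of the partial sums of \<open>x\<close> over that block, and the terms before the block are
  negligible against \<open>b n\<close>.\<close>

lemma kronecker:
  fixes x b :: "nat \<Rightarrow> real"
  assumes "mono b" "\<And>n. 0 \<le> b n" "filterlim b at_top sequentially" "summable x"
  shows "(\<lambda>n. (\<Sum>k\<le>n. b k * x k) / b n) \<longlonglongrightarrow> 0"
proof -
  let ?s = "\<lambda>n. \<Sum>k<n. x k"
  have parts: "(\<Sum>k\<in>{m..<n}. b k * x k) =
      b n * (?s n - ?s m) - (\<Sum>k\<in>{m..<n}. (b (Suc k) - b k) * (?s (Suc k) - ?s m))" if "m \<le> n" for m n
    using that by (induction n rule: dec_induct) (simp_all add: algebra_simps)
  have "(\<lambda>n. (\<Sum>k<n. b k * x k) / b n) \<longlonglongrightarrow> 0"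
  proof (rule LIMSEQ_I)
    fix r :: real assume r: "0 < r"
    have "Cauchy ?s" using assms(4) by (simp add: summable_iff_convergent Cauchy_convergent_iff)
    then obtain m where m: "\<And>n. n \<ge> m \<Longrightarrow> \<bar>?s n - ?s m\<bar> < r / 4"
      using CauchyD[OF \<open>Cauchy ?s\<close>, of "r / 4"] r by (metis real_norm_def zero_less_divide_iff zero_less_numeral order_refl)
    let ?c = "\<bar>\<Sum>k<m. b k * x k\<bar>"
    have "eventually (\<lambda>n. b n > 4 * ?c / r) sequentially"
      using assms(3) by (auto simp: filterlim_at_top_dense)
    moreover have "eventually (\<lambda>n. n \<ge> m) sequentially" by (rule eventually_ge_at_top)
    moreover have "eventually (\<lambda>n. b n > 0) sequentially"
      using assms(3) by (auto simp: filterlim_at_top_dense)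
    ultimately have "eventually (\<lambda>n. norm ((\<Sum>k<n. b k * x k) / b n - 0) < r) sequentially"
    proof eventually_elim
      case (elim n)
      have "\<bar>\<Sum>k\<in>{m..<n}. (b (Suc k) - b k) * (?s (Suc k) - ?s m)\<bar>
          \<le> (\<Sum>k\<in>{m..<n}. (b (Suc k) - b k) * (r / 4))"
      proof (intro order.trans[OF sum_abs] sum_mono)
        fix k assume "k \<in> {m..<n}"
        then have "\<bar>?s (Suc k) - ?s m\<bar> \<le> r / 4" using m[of "Suc k"] by simp
        then show "\<bar>(b (Suc k) - b k) * (?s (Suc k) - ?s m)\<bar> \<le> (b (Suc k) - b k) * (r / 4)"
          unfolding abs_mult using monoD[OF assms(1), of k "Suc k"] by (intro mult_mono) auto
      qed
      also have "\<dots> = (b n - b m) * (r / 4)"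
        using elim(2) sum_Suc_diff'[of m n b] by (simp flip: sum_distrib_right sum_divide_distrib)
      also have "\<dots> \<le> b n * (r / 4)" using assms(2)[of m] r by (intro mult_right_mono) auto
      finally have 1: "\<bar>\<Sum>k\<in>{m..<n}. (b (Suc k) - b k) * (?s (Suc k) - ?s m)\<bar> \<le> b n * (r / 4)" .
      have "\<bar>b n * (?s n - ?s m)\<bar> \<le> b n * (r / 4)"
        unfolding abs_mult using m[OF elim(2)] elim(3) by (intro mult_mono) auto
      with 1 have "\<bar>\<Sum>k\<in>{m..<n}. b k * x k\<bar> \<le> b n * (r / 2)"
        unfolding parts[OF elim(2)] by linarith
      moreover have "(\<Sum>k<n. b k * x k) = (\<Sum>k<m. b k * x k) + (\<Sum>k\<in>{m..<n}. b k * x k)"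
        using elim(2) by (simp add: sum.atLeastLessThan_concat lessThan_atLeast0)
      moreover have "?c < b n * (r / 4)" using elim(1) r by (simp add: field_simps)
      ultimately have "\<bar>\<Sum>k<n. b k * x k\<bar> < b n * r"
        using mult_pos_pos[OF elim(3) r] by (simp only: times_divide_eq_right)
      then show ?case using elim(3) by (simp add: field_simps)
    qed
    then show "\<exists>no. \<forall>n\<ge>no. norm ((\<Sum>k<n. b k * x k) / b n - 0) < r"
      by (simp add: eventually_sequentially)
  qed
  from tendsto_add[OF this summable_LIMSEQ_zero[OF assms(4)]]
  have "(\<lambda>n. (\<Sum>k<n. b k * x k) / b n + x n) \<longlonglongrightarrow> 0" by simp
  moreover have "eventually (\<lambda>n. (\<Sum>k<n. b k * x k) / b n + x n = (\<Sum>k\<le>n. b k * x k) / b n) sequentially"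
  proof -
    have "eventually (\<lambda>n. b n > 0) sequentially"
      using assms(3) by (auto simp: filterlim_at_top_dense)
    then show ?thesis
      by eventually_elim (simp add: lessThan_Suc_atMost[symmetric] field_simps)
  qed
  ultimately show ?thesis by (rule Lim_transform_eventually)
qed

section \<open>Counting the members of a class\<close>

text \<open>The counting function of a set of indices; for the members of a class it is \<open>tau\<close>. Working with a set
  keeps the results below independent of distribution functions and avoids renumbering the class.\<close>

definition cnt :: "nat set \<Rightarrow> nat \<Rightarrow> nat" where
  "cnt T n = card (T \<inter> {1..n})"

lemma cnt_0 [simp]: "cnt T 0 = 0"
  by (simp add: cnt_def)

lemma cnt_Suc: "cnt T (Suc n) = cnt T n + (if Suc n \<in> T then 1 else 0)"
proof -
  have "T \<inter> {1..Suc n} = (if Suc n \<in> T then insert (Suc n) (T \<inter> {1..n}) else T \<inter> {1..n})"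
    by (auto simp: le_Suc_eq)
  then show ?thesis by (simp add: cnt_def)
qed

lemma mono_cnt: "mono (cnt T)"
  by (auto simp: mono_iff_le_Suc cnt_Suc)

lemma cnt_pos: "k \<in> T \<Longrightarrow> 1 \<le> k \<Longrightarrow> 0 < cnt T k"
  by (auto simp: cnt_def card_gt_0_iff)

lemma cnt_le: "cnt T n \<le> n"
  by (induction n) (auto simp: cnt_Suc)

text \<open>The counting function takes each value \<open>1, \<dots>, cnt T n\<close> exactly once along \<open>T\<close>.\<close>

lemma sum_over_cnt: "(\<Sum>k=1..n. if k \<in> T then h (cnt T k) else 0) = (\<Sum>j=1..cnt T n. h j)"
  for h :: "nat \<Rightarrow> real"
  by (induction n) (auto simp: cnt_Suc)

lemma sum_inverse_cnt: "(\<Sum>k=1..n. if k \<in> T then 1 / real (cnt T k) else 0) = harm (cnt T n)"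
  using sum_over_cnt[of T "\<lambda>j. 1 / real j" n] by (simp add: harm_def inverse_eq_divide)

text \<open>The sequence \<open>harm n - ln n\<close> decreases from its value \<open>1\<close> at \<open>n = 1\<close>.\<close>

lemma harm_le_ln: "n \<ge> 1 \<Longrightarrow> harm n \<le> ln (real n) + 1"
  using decseq_harm_diff_ln[unfolded decseq_def, rule_format, of 0 "n - 1"]
  by (cases n) (auto simp: harm_def)

lemma summable_over_cnt:
  fixes h :: "nat \<Rightarrow> real"
  assumes T: "T \<subseteq> {1..}" and h: "summable h" "\<And>j. 0 \<le> h j"
  shows "summable (\<lambda>k. if k \<in> T then h (cnt T k) else 0)"
proof (rule bounded_imp_summable)
  fix n
  let ?x = "\<lambda>k. if k \<in> T then h (cnt T k) else 0"
  have "sum ?x {..n} = sum ?x {1..n}"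
    using T by (intro sum.mono_neutral_right) (auto simp: Suc_le_eq)
  also have "\<dots> = (\<Sum>j=1..cnt T n. h j)" by (rule sum_over_cnt)
  also have "\<dots> \<le> suminf h" using h by (intro sum_le_suminf) auto
  finally show "sum ?x {..n} \<le> suminf h" .
qed (use h in auto)

text \<open>Since \<open>cnt T k \<le> k\<close>, replacing \<open>g k\<close> by \<open>g (cnt T k)\<close> only enlarges the weights, and these
  are then the terms of the full series, taken in order.\<close>

lemma summable_class_weights:
  fixes g :: "nat \<Rightarrow> real"
  assumes T: "T \<subseteq> {1..}" and g: "mono g" "\<And>n. 0 < g n" and sum: "summable (\<lambda>k. 1 / (real k * g k))"
  shows "summable (\<lambda>k. if k \<in> T then 1 / (real (cnt T k) * g k) else 0)"
proof (rule summable_comparison_test_ev)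
  show "summable (\<lambda>k. if k \<in> T then 1 / (real (cnt T k) * g (cnt T k)) else 0)"
    by (rule summable_over_cnt[OF T sum]) (auto intro!: mult_nonneg_nonneg less_imp_le[OF g(2)])
  have "1 / (real (cnt T k) * g k) \<le> 1 / (real (cnt T k) * g (cnt T k))" if "k \<in> T" for k
    using that T cnt_pos[of k T] g(2)[of k] g(2)[of "cnt T k"] monoD[OF g(1) cnt_le[of T k]]
    by (intro divide_left_mono mult_left_mono mult_pos_pos) auto
  then show "eventually (\<lambda>k. norm (if k \<in> T then 1 / (real (cnt T k) * g k) else 0)
      \<le> (if k \<in> T then 1 / (real (cnt T k) * g (cnt T k)) else 0)) sequentially"
    using g(2) by (auto intro!: always_eventually simp: less_imp_le)
qed

text \<open>The partial sums of the weights \<open>1 / cnt T k\<close> over \<open>T\<close> are harmonic numbers of the counting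
  function. If these are at least a fixed proportion of the harmonic numbers of \<open>n\<close>, partial
  summation against \<open>1 / g\<close> carries divergence over to the class.\<close>

lemma not_summable_over_cnt:
  fixes g :: "nat \<Rightarrow> real" and p C :: real
  assumes T: "T \<subseteq> {1..}" and g: "mono g" "\<And>n. 0 < g n"
    and p: "0 < p" and harm: "\<And>n. p * harm n \<le> harm (cnt T n) + C"
    and div: "\<not> summable (\<lambda>k. 1 / (real k * g k))"
  shows "\<not> summable (\<lambda>k. if k \<in> T then 1 / (real (cnt T k) * g k) else 0)"
proof
  let ?w = "\<lambda>k. if k \<in> T then 1 / (real (cnt T k) * g k) else 0"
  assume sum: "summable ?w"
  have "summable (\<lambda>k. 1 / (real k * g k))"
  proof (rule bounded_imp_summable)
    fix n
    have "p * (\<Sum>k\<le>n. 1 / (real k * g k)) = (\<Sum>k=1..n. p * (1 / real k) * (1 / g k))"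
      unfolding sum_distrib_left by (intro sum.mono_neutral_cong_right) (auto simp: not_le)
    also have "\<dots> \<le> (\<Sum>k=1..n. (if k \<in> T then 1 / real (cnt T k) else 0) * (1 / g k)) + C * (1 / g 1)"
    proof (rule weighted_sum_le_by_parts)
      fix N show "(\<Sum>k=1..N. p * (1 / real k)) \<le> (\<Sum>k=1..N. if k \<in> T then 1 / real (cnt T k) else 0) + C"
        using harm[of N] unfolding sum_inverse_cnt sum_distrib_left[symmetric] by (simp add: harm_def inverse_eq_divide)
      show "antimono (\<lambda>n. 1 / g n)" using g by (intro antimonoI divide_left_mono mult_pos_pos) (auto dest: monoD)
      show "0 \<le> 1 / g N" using g(2)[of N] by simp
    qed
    also have "(\<Sum>k=1..n. (if k \<in> T then 1 / real (cnt T k) else 0) * (1 / g k)) = (\<Sum>k=1..n. ?w k)"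
      by (rule sum.cong) auto
    also have "\<dots> \<le> suminf ?w" using sum by (intro sum_le_suminf) (auto intro!: mult_nonneg_nonneg less_imp_le[OF g(2)])
    finally show "(\<Sum>k\<le>n. 1 / (real k * g k)) \<le> (suminf ?w + C * (1 / g 1)) / p"
      using p by (simp add: field_simps)
  qed (auto intro!: mult_nonneg_nonneg less_imp_le[OF g(2)])
  with div show False by simp
qed

text \<open>Harmonic numbers are logarithms up to a constant, so polynomial growth of the counting function, with
  any exponent \<open>p\<close>, costs only the factor \<open>p\<close>.\<close>

lemma harm_cnt_growth:
  assumes p: "0 < p" and c: "0 < c" and ev: "eventually (\<lambda>n. c * real n powr p \<le> real (cnt T n)) sequentially"
  shows "\<exists>C. \<forall>n. p * harm n \<le> harm (cnt T n) + C"
proof -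
  obtain N where N: "\<And>n. N \<le> n \<Longrightarrow> c * real n powr p \<le> real (cnt T n)"
    using ev by (auto simp: eventually_sequentially)
  let ?C = "max (p - ln c) (p * harm (Suc N))"
  have "p * harm n \<le> harm (cnt T n) + ?C" for n
  proof (cases "n \<le> Suc N")
    case True
    then have "p * harm n \<le> p * harm (Suc N)" using p by (intro mult_left_mono harm_mono) auto
    then show ?thesis using harm_nonneg[of "cnt T n", where 'a=real] by linarith
  next
    case False
    then have n: "1 \<le> n" "N \<le> n" by auto
    have "p * harm n \<le> p * (ln (real n) + 1)" using harm_le_ln[OF n(1)] p by (intro mult_left_mono) auto
    also have "\<dots> = ln (c * real n powr p) + (p - ln c)"
      using n c by (simp add: ln_mult ln_powr algebra_simps)
    also have "ln (c * real n powr p) \<le> ln (real (cnt T n) + 1)"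
      using N[OF n(2)] c n by (intro ln_mono) auto
    also have "\<dots> \<le> harm (cnt T n)" by (rule harm_ge_ln)
    finally show ?thesis by linarith
  qed
  then show ?thesis by blast
qed

text \<open>Convergence of the class series forces \<open>g\<close> to outgrow \<open>ln (cnt T n)\<close>: by Kronecker's lemma with
  \<open>g\<close> as the weight, the harmonic number of the counting function is \<open>o(g n)\<close>. That \<open>g\<close> is unbounded is
  needed first, and holds since a bounded \<open>g\<close> would give a harmonic series.\<close>

lemma divergent_weight_at_top:
  fixes g :: "nat \<Rightarrow> real"
  assumes T: "T \<subseteq> {1..}" and inf: "filterlim (cnt T) at_top sequentially"
    and g: "mono g" "\<And>n. 0 < g n"
    and sum: "summable (\<lambda>k. if k \<in> T then 1 / (real (cnt T k) * g k) else 0)"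
  shows "filterlim g at_top sequentially"
    and "(\<lambda>n. harm (cnt T n) / g n) \<longlonglongrightarrow> 0"
proof -
  let ?x = "\<lambda>k. if k \<in> T then 1 / (real (cnt T k) * g k) else 0"
  have x0: "0 \<le> ?x k" for k using g(2)[of k] by simp
  have harm_sum: "(\<Sum>k\<le>n. g k * ?x k) = harm (cnt T n)" for n
  proof -
    have "(\<Sum>k\<le>n. g k * ?x k) = (\<Sum>k=1..n. g k * ?x k)"
      using T by (intro sum.mono_neutral_right) (auto simp: Suc_le_eq)
    also have "\<dots> = harm (cnt T n)"
      unfolding sum_inverse_cnt[symmetric]
    proof (rule sum.cong)
      fix k show "g k * ?x k = (if k \<in> T then 1 / real (cnt T k) else 0)"
        using g(2)[of k] by simp
    qed simp
    finally show ?thesis .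
  qed
  show lim: "filterlim g at_top sequentially"
  proof (rule ccontr)
    assume "\<not> filterlim g at_top sequentially"
    then obtain K where *: "\<And>N. \<exists>n\<ge>N. g n < K"
      unfolding filterlim_at_top eventually_sequentially by (auto simp: not_le)
    have K: "g m < K" for m using *[of m] monoD[OF g(1), of m] by (auto intro: le_less_trans)
    have "harm (cnt T n) \<le> K * suminf ?x" for n
    proof -
      have "harm (cnt T n) \<le> (\<Sum>k\<le>n. K * ?x k)"
        unfolding harm_sum[symmetric] using K x0 by (intro sum_mono mult_right_mono) (auto intro: less_imp_le)
      also have "\<dots> \<le> K * suminf ?x"
        unfolding sum_distrib_left[symmetric]
        using sum x0 K[of 0] g(2)[of 0] by (intro mult_left_mono sum_le_suminf) auto
      finally show ?thesis .
    qed
    moreover have "eventually (\<lambda>n. K * suminf ?x < harm (cnt T n)) sequentially"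
      using filterlim_compose[OF harm_at_top inf] unfolding filterlim_at_top_dense by blast
    ultimately show False by (auto simp: eventually_sequentially not_less[symmetric])
  qed
  show "(\<lambda>n. harm (cnt T n) / g n) \<longlonglongrightarrow> 0"
    using kronecker[OF g(1) less_imp_le[OF g(2)] lim sum] unfolding harm_sum .
qed

lemma class_normalizer_at_top:
  fixes g :: "nat \<Rightarrow> real"
  assumes inf: "filterlim (cnt T) at_top sequentially" and \<alpha>: "0 < \<alpha>"
    and g: "mono g" "\<And>n. 0 < g n"
  shows "filterlim (\<lambda>n. (real (cnt T n) * g n) powr (1 / \<alpha>)) at_top sequentially"
proof (rule filterlim_compose[where g="\<lambda>x. x powr (1 / \<alpha>)"])
  show "filterlim (\<lambda>x::real. x powr (1 / \<alpha>)) at_top at_top" using \<alpha> by real_asymp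
  have "filterlim (\<lambda>n. real (cnt T n) * g 0) at_top sequentially"
    using g(2)[of 0] by (intro filterlim_at_top_mult_tendsto_pos[OF tendsto_const]
      filterlim_compose[OF filterlim_real_sequentially inf])
  then show "filterlim (\<lambda>n. real (cnt T n) * g n) at_top sequentially"
    by (rule filterlim_at_top_mono) (auto intro!: always_eventually mult_left_mono monoD[OF g(1)])
qed

text \<open>Condensation turns the logarithm into \<open>n * ln 2\<close>, leaving a series dominated by a multiple of
  \<open>n powr - (1 + \<delta>)\<close>.\<close>

lemma summable_inverse_mult_ln_powr:
  assumes "0 < \<delta>"
  shows "summable (\<lambda>j. 1 / (real j * (1 + ln (real (max 1 j))) powr (1 + \<delta>)))"
proof -
  let ?f = "\<lambda>j. 1 / (real j * (1 + ln (real (max 1 j))) powr (1 + \<delta>))"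
  have pos: "0 < (1 + ln (real (max 1 j))) powr (1 + \<delta>)" for j
    by (simp add: add_pos_nonneg pos_add_strict less_imp_neq[symmetric])
  have "summable ?f \<longleftrightarrow> summable (\<lambda>n. 2 ^ n * ?f (2 ^ n))"
  proof (rule condensation_test)
    fix m :: nat assume m: "0 < m"
    have "real m * (1 + ln (real (max 1 m))) powr (1 + \<delta>)
        \<le> real (Suc m) * (1 + ln (real (max 1 (Suc m)))) powr (1 + \<delta>)"
      using m assms by (intro mult_mono powr_mono2) auto
    then show "?f (Suc m) \<le> ?f m" using m pos[of m] by (intro divide_left_mono mult_pos_pos pos) auto
  qed simp
  moreover have "summable (\<lambda>n. 2 ^ n * ?f (2 ^ n))"
  proof (rule summable_comparison_test_ev)
    show "summable (\<lambda>n. ln 2 powr - (1 + \<delta>) * real n powr - (1 + \<delta>))"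
      using assms by (intro summable_mult) (simp add: summable_real_powr_iff)
    show "eventually (\<lambda>n. norm (2 ^ n * ?f (2 ^ n)) \<le> ln 2 powr - (1 + \<delta>) * real n powr - (1 + \<delta>)) sequentially"
      using eventually_ge_at_top[of 1]
    proof eventually_elim
      case (elim n)
      have "2 ^ n * ?f (2 ^ n) = (1 + real n * ln 2) powr - (1 + \<delta>)"
        using powr_minus_divide[of "1 + real n * ln 2" "1 + \<delta>"] by (simp add: max_def ln_realpow)
      also have "\<dots> \<le> (real n * ln 2) powr - (1 + \<delta>)"
        using elim assms by (intro powr_mono2') auto
      also have "\<dots> = ln 2 powr - (1 + \<delta>) * real n powr - (1 + \<delta>)"
        by (simp add: powr_mult)
      finally show ?case by simp
    qed
  qed
  ultimately show ?thesis by simp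
qed

section \<open>Kolmogorov's convergence criterion\<close>

text \<open>The partial sums of \<open>y\<close>, frozen as soon as they reach absolute value \<open>e\<close>. For them the event that
  some partial sum reaches \<open>e\<close> becomes an event about the last one, and Chebyshev's inequality applies.\<close>

primrec stopped_sum :: "real \<Rightarrow> (nat \<Rightarrow> real) \<Rightarrow> nat \<Rightarrow> real" where
  "stopped_sum e y 0 = 0"
| "stopped_sum e y (Suc n) =
     (if e \<le> \<bar>stopped_sum e y n\<bar> then stopped_sum e y n else stopped_sum e y n + y n)"

lemma stopped_sum_exceeds:
  assumes "0 < e" "k \<le> n" "e \<le> \<bar>\<Sum>i<k. y i\<bar>"
  shows "e \<le> \<bar>stopped_sum e y n\<bar>"
proof -
  have "(stopped_sum e y n = (\<Sum>i<n. y i) \<and> (\<forall>k\<le>n. \<bar>\<Sum>i<k. y i\<bar> < e)) \<or> e \<le> \<bar>stopped_sum e y n\<bar>"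
    using assms(1) by (induction n) (auto simp: le_Suc_eq not_le)
  then show ?thesis using assms by force
qed

lemma stopped_sum_cong: "(\<And>i. i < n \<Longrightarrow> y i = z i) \<Longrightarrow> stopped_sum e y n = stopped_sum e z n"
  by (induction n) auto

lemma measurable_stopped_sum:
  assumes "\<And>i. i < n \<Longrightarrow> (\<lambda>\<omega>. Y i \<omega>) \<in> borel_measurable N"
  shows "(\<lambda>\<omega>. stopped_sum e (\<lambda>i. Y i \<omega>) n) \<in> borel_measurable N"
  using assms
proof (induction n)
  case (Suc n)
  then have [measurable]: "(\<lambda>\<omega>. stopped_sum e (\<lambda>i. Y i \<omega>) n) \<in> borel_measurable N" "Y n \<in> borel_measurable N"
    by auto
  show ?case by simp
qed simp

context prob_space
begin

text \<open>Each increment of the stopped sum is a function of the past times an independent centred variable, so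
  the cross term vanishes and the second moment grows by at most that of the new variable.\<close>

lemma stopped_sum_square:
  fixes Y :: "nat \<Rightarrow> 'a \<Rightarrow> real"
  assumes indep: "indep_vars (\<lambda>_. borel) Y UNIV"
    and sq: "\<And>i. integrable M (\<lambda>\<omega>. (Y i \<omega>)\<^sup>2)"
    and mean: "\<And>i. expectation (Y i) = 0"
  shows "integrable M (\<lambda>\<omega>. (stopped_sum e (\<lambda>i. Y i \<omega>) n)\<^sup>2)
    \<and> expectation (\<lambda>\<omega>. (stopped_sum e (\<lambda>i. Y i \<omega>) n)\<^sup>2) \<le> (\<Sum>i<n. expectation (\<lambda>\<omega>. (Y i \<omega>)\<^sup>2))"
proof (induction n)
  case (Suc n)
  have Y[measurable]: "\<And>i. Y i \<in> borel_measurable M" using indep by (auto simp: indep_vars_def)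
  let ?Z = "\<lambda>\<omega>. stopped_sum e (\<lambda>i. Y i \<omega>) n"
  define w where "w z = (if e \<le> \<bar>z\<bar> then 0 else z)" for z :: real
  define u where "u z = (if e \<le> \<bar>z\<bar> then 0 else 1::real)" for z :: real
  have [measurable]: "w \<in> borel_measurable borel" "u \<in> borel_measurable borel"
    unfolding w_def[abs_def] u_def[abs_def] by measurable
  have Z[measurable]: "?Z \<in> borel_measurable M" by (rule measurable_stopped_sum) simp
  have intY: "integrable M (Y n)" by (rule square_integrable_imp_integrable) (use sq in auto)
  have intw: "integrable M (\<lambda>\<omega>. w (?Z \<omega>))"
    by (rule integrable_const_bound[of _ "\<bar>e\<bar>"]) (auto simp: w_def)
  have "indep_var borel ((\<lambda>y. y n) \<circ> (\<lambda>\<omega>. restrict (\<lambda>i. Y i \<omega>) {n}))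
      borel ((\<lambda>y. w (stopped_sum e y n)) \<circ> (\<lambda>\<omega>. restrict (\<lambda>i. Y i \<omega>) {..<n}))"
    by (intro indep_var_compose[OF indep_var_restrict[OF indep]])
      (auto intro!: measurable_compose[OF measurable_stopped_sum[where Y="\<lambda>i y. y i"]])
  moreover have "(\<lambda>y. w (stopped_sum e y n)) \<circ> (\<lambda>\<omega>. restrict (\<lambda>i. Y i \<omega>) {..<n}) = (\<lambda>\<omega>. w (?Z \<omega>))"
    by (auto simp: fun_eq_iff intro!: arg_cong[where f=w] stopped_sum_cong)
  moreover have "(\<lambda>y. y n) \<circ> (\<lambda>\<omega>. restrict (\<lambda>i. Y i \<omega>) {n}) = Y n" by auto
  ultimately have ind: "indep_var borel (Y n) borel (\<lambda>\<omega>. w (?Z \<omega>))" by simp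
  have cross: "integrable M (\<lambda>\<omega>. Y n \<omega> * w (?Z \<omega>))" "expectation (\<lambda>\<omega>. Y n \<omega> * w (?Z \<omega>)) = 0"
    using indep_var_integrable[OF ind intY intw] indep_var_lebesgue_integral[OF ind intY intw] mean by auto
  have intu: "integrable M (\<lambda>\<omega>. u (?Z \<omega>) * (Y n \<omega>)\<^sup>2)"
    by (rule Bochner_Integration.integrable_bound[OF sq[of n]]) (auto simp: u_def)
  have eq: "(stopped_sum e (\<lambda>i. Y i \<omega>) (Suc n))\<^sup>2
      = (?Z \<omega>)\<^sup>2 + 2 * (Y n \<omega> * w (?Z \<omega>)) + u (?Z \<omega>) * (Y n \<omega>)\<^sup>2" for \<omega>
    by (auto simp: w_def u_def power2_eq_square algebra_simps)
  have "expectation (\<lambda>\<omega>. u (?Z \<omega>) * (Y n \<omega>)\<^sup>2) \<le> expectation (\<lambda>\<omega>. (Y n \<omega>)\<^sup>2)"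
    by (rule integral_mono[OF intu sq]) (auto simp: u_def)
  then show ?case
    unfolding eq using Suc cross intu by auto
qed simp

lemma kolmogorov_maximal:
  fixes Y :: "nat \<Rightarrow> 'a \<Rightarrow> real"
  assumes indep: "indep_vars (\<lambda>_. borel) Y UNIV"
    and sq: "\<And>i. integrable M (\<lambda>\<omega>. (Y i \<omega>)\<^sup>2)"
    and mean: "\<And>i. expectation (Y i) = 0"
    and e: "0 < e"
  shows "prob {\<omega>\<in>space M. \<exists>k\<le>n. e \<le> \<bar>\<Sum>i<k. Y i \<omega>\<bar>} \<le> (\<Sum>i<n. expectation (\<lambda>\<omega>. (Y i \<omega>)\<^sup>2)) / e\<^sup>2"
proof -
  have Y[measurable]: "\<And>i. Y i \<in> borel_measurable M" using indep by (auto simp: indep_vars_def)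
  let ?Z = "\<lambda>\<omega>. stopped_sum e (\<lambda>i. Y i \<omega>) n"
  have Z[measurable]: "?Z \<in> borel_measurable M" by (rule measurable_stopped_sum) simp
  note sqZ = stopped_sum_square[OF indep sq mean, of e n]
  have "prob {\<omega>\<in>space M. \<exists>k\<le>n. e \<le> \<bar>\<Sum>i<k. Y i \<omega>\<bar>} \<le> prob {\<omega>\<in>space M. e\<^sup>2 \<le> (?Z \<omega>)\<^sup>2}"
    using stopped_sum_exceeds[OF e] e
    by (intro finite_measure_mono) (auto simp: abs_le_square_iff[symmetric])
  also have "\<dots> \<le> expectation (\<lambda>\<omega>. (?Z \<omega>)\<^sup>2) / e\<^sup>2"
    using sqZ e integral_Markov_inequality_measure[of M "\<lambda>\<omega>. (?Z \<omega>)\<^sup>2" "{}" "e\<^sup>2"] by simp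
  also have "\<dots> \<le> (\<Sum>i<n. expectation (\<lambda>\<omega>. (Y i \<omega>)\<^sup>2)) / e\<^sup>2"
    using sqZ e by (intro divide_right_mono) auto
  finally show ?thesis .
qed

text \<open>Needed to shift indices: the variables are independent over the positive integers, whereas series
  and tails of series are indexed from \<open>0\<close>.\<close>

lemma indep_vars_inj_reindex:
  assumes "indep_vars N X I" "inj_on h J" "h ` J \<subseteq> I"
  shows "indep_vars (\<lambda>j. N (h j)) (\<lambda>j. X (h j)) J"
proof -
  have J: "\<And>j. j \<in> J \<Longrightarrow> h j \<in> I" using assms(3) by auto
  have "indep_sets (\<lambda>j. {X (h j) -` A \<inter> space M |A. A \<in> sets (N (h j))}) J"
  proof (rule indep_setsI)
    fix j assume "j \<in> J" then show "{X (h j) -` A \<inter> space M |A. A \<in> sets (N (h j))} \<subseteq> events"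
      using assms(1) J by (auto simp: indep_vars_def2 intro!: measurable_sets)
  next
    fix A K assume K: "K \<noteq> {}" "K \<subseteq> J" "finite K" and
      A: "\<forall>j\<in>K. A j \<in> {X (h j) -` A \<inter> space M |A. A \<in> sets (N (h j))}"
    have inj: "inj_on h K" using assms(2) K(2) by (rule inj_on_subset)
    have "indep_sets (\<lambda>i. {X i -` A \<inter> space M |A. A \<in> sets (N i)}) I"
      using assms(1) by (simp add: indep_vars_def2)
    moreover have "h ` K \<subseteq> I" using K(2) J by auto
    ultimately show "prob (\<Inter>j\<in>K. A j) = (\<Prod>j\<in>K. prob (A j))" 
      using indep_setsD[of _ I "h ` K" "\<lambda>i. A (the_inv_into K h i)"] K A J inj
      by (auto simp: the_inv_into_f_f prod.reindex cong: prod.cong INF_cong)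
  qed
  then show ?thesis using assms(1) J by (auto simp: indep_vars_def2)
qed

text \<open>The maximal inequality, applied to the tails of the series, shows that with probability one the partial
  sums eventually oscillate by less than any given amount.\<close>

lemma kolmogorov_convergence:
  fixes Y :: "nat \<Rightarrow> 'a \<Rightarrow> real"
  assumes indep: "indep_vars (\<lambda>_. borel) Y UNIV"
    and sq: "\<And>i. integrable M (\<lambda>\<omega>. (Y i \<omega>)\<^sup>2)"
    and mean: "\<And>i. expectation (Y i) = 0"
    and v: "summable (\<lambda>i. expectation (\<lambda>\<omega>. (Y i \<omega>)\<^sup>2))"
  shows "AE \<omega> in M. summable (\<lambda>i. Y i \<omega>)"
proof -
  have Y[measurable]: "\<And>i. Y i \<in> borel_measurable M" using indep by (auto simp: indep_vars_def)
  let ?v = "\<lambda>i. expectation (\<lambda>\<omega>. (Y i \<omega>)\<^sup>2)"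
  define R where "R m = (\<Sum>i. ?v (i + m))" for m
  have R0: "R \<longlonglongrightarrow> 0" unfolding R_def[abs_def] using suminf_exist_split2[OF v] .
  define A where "A e m n = {\<omega>\<in>space M. \<exists>k\<le>n. e \<le> \<bar>\<Sum>i<k. Y (i + m) \<omega>\<bar>}" for e m n
  have A[measurable]: "A e m n \<in> sets M" for e m n unfolding A_def by measurable
  have PA: "prob (A e m n) \<le> R m / e\<^sup>2" if "0 < e" for e m n
  proof -
    have "prob (A e m n) \<le> (\<Sum>i<n. ?v (i + m)) / e\<^sup>2"
      unfolding A_def
      by (intro kolmogorov_maximal that sq mean indep_vars_inj_reindex[OF indep]) (auto simp: inj_on_def)
    also have "\<dots> \<le> R m / e\<^sup>2" unfolding R_def
      using v that by (intro divide_right_mono sum_le_suminf) (auto intro: summable_ignore_initial_segment)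
    finally show ?thesis .
  qed
  have "AE \<omega> in M. \<exists>m. \<forall>n. \<omega> \<notin> A e m n" if e: "0 < e" for e
  proof -
    let ?N = "\<Inter>m. \<Union>n. A e m n"
    have "prob ?N \<le> R m / e\<^sup>2" for m
    proof -
      have "prob ?N \<le> prob (\<Union>n. A e m n)" by (intro finite_measure_mono) auto
      also have "(\<lambda>n. prob (A e m n)) \<longlonglongrightarrow> prob (\<Union>n. A e m n)"
        by (rule finite_Lim_measure_incseq) (auto simp: incseq_def A_def intro: order_trans)
      then have "prob (\<Union>n. A e m n) \<le> R m / e\<^sup>2"
        by (rule LIMSEQ_le_const2) (use PA[OF e] in auto)
      finally show ?thesis .
    qed
    moreover have "(\<lambda>m. R m / e\<^sup>2) \<longlonglongrightarrow> 0" using tendsto_divide[OF R0 tendsto_const, of "e\<^sup>2"] e by simp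
    ultimately have "prob ?N \<le> 0" by (intro LIMSEQ_le_const[where X="\<lambda>m. R m / e\<^sup>2"]) auto
    then have "prob ?N = 0" by (simp add: measure_le_0_iff)
    then have "AE \<omega> in M. \<omega> \<notin> ?N" by (subst (asm) prob_eq_0) auto
    then show ?thesis by eventually_elim auto
  qed
  then have "AE \<omega> in M. \<forall>j. \<exists>m. \<forall>n. \<omega> \<notin> A (1 / real (Suc j)) m n"
    by (simp add: AE_all_countable)
  with AE_space show ?thesis
  proof (eventually_elim, intro summable_Cauchy[THEN iffD2] allI impI)
    fix \<omega> and r :: real
    assume \<omega>: "\<omega> \<in> space M" "\<forall>j. \<exists>m. \<forall>n. \<omega> \<notin> A (1 / real (Suc j)) m n" and r: "0 < r"
    obtain j where j: "1 / real (Suc j) < r / 2" using r reals_Archimedean[of "r / 2"] by (auto simp: inverse_eq_divide)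
    obtain m where m: "\<And>n. \<omega> \<notin> A (1 / real (Suc j)) m n" using \<omega>(2) by blast
    have tail: "\<bar>\<Sum>i\<in>{m..<n}. Y i \<omega>\<bar> < 1 / real (Suc j)" if "m \<le> n" for n
    proof -
      have "(\<Sum>i\<in>{m..<n}. Y i \<omega>) = (\<Sum>i<n - m. Y (i + m) \<omega>)"
        using sum.shift_bounds_nat_ivl[of "\<lambda>i. Y i \<omega>" 0 m "n - m"] that by (simp add: lessThan_atLeast0)
      then show ?thesis using m[of "n - m"] \<omega>(1) unfolding A_def by (auto simp: not_le)
    qed
    show "\<exists>N. \<forall>a\<ge>N. \<forall>b. norm (\<Sum>i\<in>{a..<b}. Y i \<omega>) < r"
    proof (intro exI[of _ m] allI impI)
      fix a b assume a: "m \<le> a"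
      show "norm (\<Sum>i\<in>{a..<b}. Y i \<omega>) < r"
      proof (cases "a \<le> b")
        case True
        have "(\<Sum>i\<in>{m..<b}. Y i \<omega>) = (\<Sum>i\<in>{m..<a}. Y i \<omega>) + (\<Sum>i\<in>{a..<b}. Y i \<omega>)"
          using a True by (simp add: sum.atLeastLessThan_concat)
        moreover have "\<bar>\<Sum>i\<in>{m..<b}. Y i \<omega>\<bar> < 1 / real (Suc j)" using tail[of b] a True by simp
        ultimately show ?thesis using tail[OF a] j unfolding real_norm_def by linarith
      qed (use r in simp)
    qed
  qed
qed

section \<open>Truncated moments under power tails\<close>

text \<open>A discrete layer-cake bound: if every nonzero value \<open>h y\<close> is at most some \<open>c i\<close> with
  \<open>\<bar>y\<bar>\<close> above the level \<open>l i\<close>, then \<open>h (X \<omega>)\<close> is dominated by the sum of all \<open>c i\<close> times the indicator of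
  \<open>\<bar>X \<omega>\<bar> > l i\<close>. Dyadic levels give all moment bounds needed below.\<close>

lemma level_sum_bound:
  fixes X :: "'a \<Rightarrow> real" and h :: "real \<Rightarrow> real" and c l :: "nat \<Rightarrow> real"
  assumes X[measurable]: "X \<in> borel_measurable M"
    and tail: "\<And>x. 0 < x \<Longrightarrow> prob {\<omega>\<in>space M. x < \<bar>X \<omega>\<bar>} \<le> C * x powr - \<alpha>"
    and h[measurable]: "h \<in> borel_measurable borel" and h_nonneg: "\<And>y. 0 \<le> h y"
    and levels: "\<And>y. h y \<noteq> 0 \<Longrightarrow> \<exists>i. h y \<le> c i \<and> l i < \<bar>y\<bar>"
    and c: "\<And>i. 0 \<le> c i" and l: "\<And>i. 0 < l i"
    and s: "(\<lambda>i. c i * l i powr - \<alpha>) sums s"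
  shows "integrable M (\<lambda>\<omega>. h (X \<omega>))" "expectation (\<lambda>\<omega>. h (X \<omega>)) \<le> C * s"
proof -
  have C: "0 \<le> C" using tail[of 1] order_trans[OF measure_nonneg] by fastforce
  have s_nonneg: "0 \<le> C * s"
    using C c sums_le[OF _ sums_zero s] by simp
  let ?A = "\<lambda>i. {\<omega>\<in>space M. l i < \<bar>X \<omega>\<bar>}"
  have "(\<integral>\<^sup>+\<omega>. ennreal (h (X \<omega>)) \<partial>M) \<le> (\<integral>\<^sup>+\<omega>. (\<Sum>i. ennreal (c i) * indicator (?A i) \<omega>) \<partial>M)"
  proof (rule nn_integral_mono)
    fix \<omega> assume \<omega>: "\<omega> \<in> space M"
    show "ennreal (h (X \<omega>)) \<le> (\<Sum>i. ennreal (c i) * indicator (?A i) \<omega>)"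
    proof (cases "h (X \<omega>) = 0")
      case False
      then obtain i where i: "h (X \<omega>) \<le> c i" "l i < \<bar>X \<omega>\<bar>" using levels by blast
      have "ennreal (h (X \<omega>)) \<le> ennreal (c i) * indicator (?A i) \<omega>"
        using i \<omega> by (simp add: ennreal_leI)
      also have "\<dots> \<le> (\<Sum>i. ennreal (c i) * indicator (?A i) \<omega>)"
        by (rule order_trans[OF _ sum_le_suminf[of _ "{i}"]]) (simp_all only: sum.insert[OF finite.emptyI] empty_iff not_False_eq_True sum.empty add_0_right order_refl summableI finite.emptyI finite_insert zero_le)
      finally show ?thesis .
    qed simp
  qed
  also have "\<dots> = (\<Sum>i. ennreal (c i) * emeasure M (?A i))"
    by (subst nn_integral_suminf) (auto simp: nn_integral_cmult_indicator)
  also have "\<dots> \<le> (\<Sum>i. ennreal (C * (c i * l i powr - \<alpha>)))"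
  proof (intro suminf_le summableI)
    fix i
    have "c i * prob (?A i) \<le> c i * (C * l i powr - \<alpha>)" using tail[OF l] c by (intro mult_left_mono) auto
    then show "ennreal (c i) * emeasure M (?A i) \<le> ennreal (C * (c i * l i powr - \<alpha>))"
      using c by (simp add: emeasure_eq_measure ennreal_mult[symmetric] ac_simps ennreal_leI)
  qed
  also have "\<dots> = ennreal (C * s)"
    using C c s by (intro suminf_ennreal_eq sums_mult) auto
  finally have le: "(\<integral>\<^sup>+\<omega>. ennreal (h (X \<omega>)) \<partial>M) \<le> ennreal (C * s)" .
  then show int: "integrable M (\<lambda>\<omega>. h (X \<omega>))"
    using h_nonneg by (intro integrableI_bounded) (auto intro: le_less_trans)
  show "expectation (\<lambda>\<omega>. h (X \<omega>)) \<le> C * s"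
    using le s_nonneg h_nonneg by (simp add: nn_integral_eq_integral[OF int])
qed

text \<open>Dyadic levels \<open>a / 2 ^ Suc i\<close> below \<open>a\<close>; the resulting series is geometric because \<open>p > \<alpha>\<close>.\<close>

lemma truncated_moment_bound:
  fixes X :: "'a \<Rightarrow> real"
  assumes X[measurable]: "X \<in> borel_measurable M"
    and tail: "\<And>x. 0 < x \<Longrightarrow> prob {\<omega>\<in>space M. x < \<bar>X \<omega>\<bar>} \<le> C * x powr - \<alpha>"
    and p: "\<alpha> < real p" "1 \<le> p" and a: "0 < a"
  shows "expectation (\<lambda>\<omega>. if \<bar>X \<omega>\<bar> \<le> a then \<bar>X \<omega>\<bar> ^ p else 0)
    \<le> C * (2 powr \<alpha> / (1 - 2 powr (\<alpha> - p)) * a powr (p - \<alpha>))"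
proof (rule level_sum_bound(2)[OF X tail, where c="\<lambda>i. (a / 2 ^ i) ^ p" and l="\<lambda>i. a / 2 ^ Suc i"])
  let ?h = "\<lambda>y::real. if \<bar>y\<bar> \<le> a then \<bar>y\<bar> ^ p else 0"
  fix y assume "?h y \<noteq> 0"
  then have y: "0 < \<bar>y\<bar>" "\<bar>y\<bar> \<le> a" using p(2) by (auto split: if_splits simp: power_0_left)
  obtain n where "(1 / 2) ^ n < \<bar>y\<bar> / a" using real_arch_pow_inv[of "\<bar>y\<bar> / a" "1 / 2"] y a by auto
  then have ex: "\<exists>n. a / 2 ^ n < \<bar>y\<bar>" using a by (auto simp: field_simps power_divide)
  define m where "m = (LEAST n. a / 2 ^ n < \<bar>y\<bar>)"
  have m: "a / 2 ^ m < \<bar>y\<bar>" unfolding m_def by (rule LeastI_ex[OF ex])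
  then obtain i where i: "m = Suc i" using y by (cases m) auto
  have "\<not> a / 2 ^ i < \<bar>y\<bar>" using not_less_Least[of i "\<lambda>n. a / 2 ^ n < \<bar>y\<bar>"] i by (simp add: m_def)
  then show "\<exists>i. ?h y \<le> (a / 2 ^ i) ^ p \<and> a / 2 ^ Suc i < \<bar>y\<bar>"
    using m i y by (intro exI[of _ i]) (auto intro!: power_mono)
next
  have eq: "(a / 2 ^ i) ^ p * (a / 2 ^ Suc i) powr - \<alpha>
      = 2 powr \<alpha> * a powr (p - \<alpha>) * (2 powr (\<alpha> - p)) ^ i" for i
    using a by (simp add: powr_realpow[symmetric] powr_divide powr_powr powr_diff powr_add powr_minus field_simps powr_mult)
  have r: "\<bar>2 powr (\<alpha> - p)\<bar> < 1" using p by (simp add: powr_less_one)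
  show "(\<lambda>i. (a / 2 ^ i) ^ p * (a / 2 ^ Suc i) powr - \<alpha>) sums (2 powr \<alpha> / (1 - 2 powr (\<alpha> - p)) * a powr (p - \<alpha>))"
    unfolding eq using sums_mult[OF geometric_sums, of "2 powr (\<alpha> - p)" "2 powr \<alpha> * a powr (p - \<alpha>)"] r
    by (simp add: field_simps)
qed (use a in \<open>auto\<close>)

text \<open>Dyadic levels \<open>a * 2 ^ i\<close> above \<open>a\<close>; the resulting series is geometric because \<open>\<alpha> > 1\<close>.\<close>

lemma tail_moment_bound:
  fixes X :: "'a \<Rightarrow> real"
  assumes X[measurable]: "X \<in> borel_measurable M"
    and tail: "\<And>x. 0 < x \<Longrightarrow> prob {\<omega>\<in>space M. x < \<bar>X \<omega>\<bar>} \<le> C * x powr - \<alpha>"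
    and \<alpha>: "1 < \<alpha>" and a: "0 < a"
  shows "integrable M (\<lambda>\<omega>. if a < \<bar>X \<omega>\<bar> then \<bar>X \<omega>\<bar> else 0)" (is ?int)
    and "expectation (\<lambda>\<omega>. if a < \<bar>X \<omega>\<bar> then \<bar>X \<omega>\<bar> else 0)
      \<le> C * (2 / (1 - 2 powr (1 - \<alpha>)) * a powr (1 - \<alpha>))" (is ?le)
proof -
  let ?h = "\<lambda>y::real. if a < \<bar>y\<bar> then \<bar>y\<bar> else 0"
  have levels: "\<exists>i. ?h y \<le> a * 2 ^ Suc i \<and> a * 2 ^ i < \<bar>y\<bar>" if "?h y \<noteq> 0" for y
  proof -
    have y: "a < \<bar>y\<bar>" using that by (auto split: if_splits)
    obtain n where "\<bar>y\<bar> / a < 2 ^ n" using real_arch_pow[of 2 "\<bar>y\<bar> / a"] by auto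
    then have ex: "\<exists>n. \<bar>y\<bar> \<le> a * 2 ^ n" using a by (auto simp: field_simps intro: less_imp_le)
    define m where "m = (LEAST n. \<bar>y\<bar> \<le> a * 2 ^ n)"
    have m: "\<bar>y\<bar> \<le> a * 2 ^ m" unfolding m_def by (rule LeastI_ex[OF ex])
    then obtain i where i: "m = Suc i" using y by (cases m) auto
    have "\<not> \<bar>y\<bar> \<le> a * 2 ^ i" using not_less_Least[of i "\<lambda>n. \<bar>y\<bar> \<le> a * 2 ^ n"] i by (simp add: m_def)
    then show ?thesis using m i y by (intro exI[of _ i]) auto
  qed
  have eq: "a * 2 ^ Suc i * (a * 2 ^ i) powr - \<alpha> = 2 * a powr (1 - \<alpha>) * (2 powr (1 - \<alpha>)) ^ i" for i
    using a by (simp add: powr_realpow[symmetric] powr_powr powr_diff powr_add powr_minus field_simps powr_mult)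
  have r: "\<bar>2 powr (1 - \<alpha>)\<bar> < 1" using \<alpha> by (simp add: powr_less_one)
  have sums: "(\<lambda>i. a * 2 ^ Suc i * (a * 2 ^ i) powr - \<alpha>) sums (2 / (1 - 2 powr (1 - \<alpha>)) * a powr (1 - \<alpha>))"
    unfolding eq using sums_mult[OF geometric_sums, of "2 powr (1 - \<alpha>)" "2 * a powr (1 - \<alpha>)"] r
    by (simp add: field_simps)
  show ?int by (rule level_sum_bound(1)[OF X tail _ _ levels _ _ sums]) (use a in auto)
  show ?le by (rule level_sum_bound(2)[OF X tail _ _ levels _ _ sums]) (use a in auto)
qed

text \<open>In the critical case every dyadic level contributes the same amount, and there are about \<open>log 2 a\<close> levels
  between \<open>1\<close> and \<open>a\<close>.\<close>

lemma truncated_mean_log_bound: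
  fixes X :: "'a \<Rightarrow> real"
  assumes X[measurable]: "X \<in> borel_measurable M"
    and tail: "\<And>x. 0 < x \<Longrightarrow> prob {\<omega>\<in>space M. x < \<bar>X \<omega>\<bar>} \<le> C * x powr - 1"
    and a: "1 \<le> a"
  shows "expectation (\<lambda>\<omega>. if \<bar>X \<omega>\<bar> \<le> a then \<bar>X \<omega>\<bar> else 0) \<le> 1 + C * (2 * (log 2 a + 1))"
proof -
  let ?h = "\<lambda>y::real. if 1 < \<bar>y\<bar> \<and> \<bar>y\<bar> \<le> a then \<bar>y\<bar> else 0"
  define N where "N = Suc (nat \<lfloor>log 2 a\<rfloor>)"
  have N: "real N \<le> log 2 a + 1" "a \<le> 2 ^ N"
  proof -
    have "0 \<le> log 2 a" using a by simp
    then show "real N \<le> log 2 a + 1" by (simp add: N_def)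
    have "a = 2 powr log 2 a" using a by simp
    also have "\<dots> \<le> 2 powr N" unfolding N_def by (intro powr_mono) linarith+
    finally show "a \<le> 2 ^ N" by (simp add: powr_realpow)
  qed
  let ?c = "\<lambda>i. if i < N then 2 ^ Suc i else 0 :: real" and ?l = "\<lambda>i. 2 ^ i :: real"
  have levels: "\<exists>i. ?h y \<le> ?c i \<and> ?l i < \<bar>y\<bar>" if "?h y \<noteq> 0" for y
  proof -
    have y: "1 < \<bar>y\<bar>" "\<bar>y\<bar> \<le> a" using that by (auto split: if_splits)
    then have ex: "\<bar>y\<bar> \<le> 2 ^ N" using N by linarith
    define m where "m = (LEAST n. \<bar>y\<bar> \<le> 2 ^ n)"
    have m: "\<bar>y\<bar> \<le> 2 ^ m" unfolding m_def by (rule LeastI[of "\<lambda>n. \<bar>y\<bar> \<le> 2 ^ n", OF ex])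
    have "m \<le> N" unfolding m_def by (rule Least_le[of "\<lambda>n. \<bar>y\<bar> \<le> 2 ^ n", OF ex])
    obtain i where i: "m = Suc i" using y m by (cases m) auto
    have "\<not> \<bar>y\<bar> \<le> 2 ^ i" using not_less_Least[of i "\<lambda>n. \<bar>y\<bar> \<le> 2 ^ n"] i by (simp add: m_def)
    then show ?thesis using m i y \<open>m \<le> N\<close> by (intro exI[of _ i]) auto
  qed
  have "(\<lambda>i. ?c i * ?l i powr - 1) sums (\<Sum>i<N. ?c i * ?l i powr - 1)"
    by (rule sums_finite) auto
  also have "(\<Sum>i<N. ?c i * ?l i powr - 1) = (\<Sum>i<N. 2)"
    by (rule sum.cong) (auto simp: powr_minus)
  also have "\<dots> = 2 * real N" by simp
  finally have sums: "(\<lambda>i. ?c i * ?l i powr - 1) sums (2 * real N)" .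
  have int: "integrable M (\<lambda>\<omega>. ?h (X \<omega>))" and le: "expectation (\<lambda>\<omega>. ?h (X \<omega>)) \<le> C * (2 * real N)"
    by (rule level_sum_bound[OF X tail _ _ levels _ _ sums]; auto)+
  have C: "0 \<le> C" using tail[of 1] order_trans[OF measure_nonneg] by fastforce
  have "expectation (\<lambda>\<omega>. if \<bar>X \<omega>\<bar> \<le> a then \<bar>X \<omega>\<bar> else 0) \<le> expectation (\<lambda>\<omega>. 1 + ?h (X \<omega>))"
    using int by (intro integral_mono) (use a in \<open>auto intro!: integrable_const_bound[of _ a]\<close>)
  also have "\<dots> \<le> 1 + C * (2 * real N)" using int le by (simp add: prob_space)
  also have "\<dots> \<le> 1 + C * (2 * (log 2 a + 1))" using N C by (intro add_left_mono mult_left_mono) auto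
  finally show ?thesis .
qed

section \<open>Convergent series: the class sum is negligible\<close>

text \<open>The convergent half. A variable of the class splits into its centred truncation at \<open>b k\<close>, the
  truncated mean, and the part beyond \<open>b k\<close>; the partial sums of each piece are \<open>o(b n)\<close>.\<close>

lemma class_sum_negligible:
  fixes X :: "nat \<Rightarrow> 'a \<Rightarrow> real" and g :: "nat \<Rightarrow> real"
  assumes indep: "indep_vars (\<lambda>_. borel) X {1..}"
    and T: "T \<subseteq> {1..}" and inf: "filterlim (cnt T) at_top sequentially"
    and \<alpha>: "0 < \<alpha>" "\<alpha> < 2"
    and tail: "\<And>k x. k \<in> T \<Longrightarrow> 0 < x \<Longrightarrow> prob {\<omega>\<in>space M. x < \<bar>X k \<omega>\<bar>} \<le> C * x powr - \<alpha>"
    and centred: "\<And>k. 1 < \<alpha> \<Longrightarrow> k \<in> T \<Longrightarrow> expectation (X k) = 0"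
    and g: "mono g" "\<And>n. 0 < g n"
    and sum: "summable (\<lambda>k. if k \<in> T then 1 / (real (cnt T k) * g k) else 0)"
  shows "AE \<omega> in M. (\<lambda>n. (\<Sum>k\<in>T \<inter> {1..n}. X k \<omega>) / (real (cnt T n) * g n) powr (1 / \<alpha>)) \<longlonglongrightarrow> 0"
proof -
  define b where "b n = (real (cnt T n) * g n) powr (1 / \<alpha>)" for n
  define u where "u k = (if k \<in> T then 1 / (real (cnt T k) * g k) else 0)" for k
  have u: "summable u" using sum unfolding u_def .
  have u0: "0 \<le> u k" for k using g(2)[of k] by (simp add: u_def)
  have Xm[measurable]: "X k \<in> borel_measurable M" if "1 \<le> k" for k using indep that by (auto simp: indep_vars_def)
  have XT: "X k \<in> borel_measurable M" "1 \<le> k" if "k \<in> T" for k using Xm T that by auto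
  have mono_b: "mono b"
  proof (rule monoI)
    fix m n :: nat assume "m \<le> n"
    then show "b m \<le> b n"
      unfolding b_def using g(2)[of m] \<alpha>(1) monoD[OF mono_cnt[of T], of m n] monoD[OF g(1), of m n]
      by (intro powr_mono2 mult_mono) simp_all
  qed
  have b0: "0 \<le> b n" for n by (simp add: b_def)
  have bpos: "0 < b k" if "k \<in> T" for k
    using cnt_pos[OF that XT(2)[OF that]] g(2)[of k] by (simp add: b_def)
  have b_powr: "b k powr - \<alpha> = u k" if "k \<in> T" for k
    using cnt_pos[OF that XT(2)[OF that]] g(2)[of k] \<alpha> that
    by (simp add: b_def u_def powr_powr powr_minus inverse_eq_divide)
  have b_lim: "filterlim b at_top sequentially"
    unfolding b_def[abs_def] using inf \<alpha>(1) g by (rule class_normalizer_at_top)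
  have C: "0 \<le> C" if "k \<in> T" for k using order_trans[OF measure_nonneg tail[OF that, of 1]] by simp

  define h where "h k y = (if k \<in> T \<and> \<bar>y\<bar> \<le> b k then y else 0)" for k and y :: real
  have [measurable]: "h k \<in> borel_measurable borel" for k unfolding h_def[abs_def] by measurable
  define e where "e k = expectation (\<lambda>\<omega>. h k (X k \<omega>))" for k
  define Y where "Y k \<omega> = h k (X k \<omega>) - e k" for k \<omega>
  have h_int: "integrable M (\<lambda>\<omega>. h k (X k \<omega>))" "integrable M (\<lambda>\<omega>. (h k (X k \<omega>))\<^sup>2)" if "1 \<le> k" for k
  proof -
    have "\<bar>h k y\<bar> \<le> b k" for y using b0 by (simp add: h_def)
    moreover from this have "(h k y)\<^sup>2 \<le> (b k)\<^sup>2" for y using b0 abs_le_square_iff[of "h k y" "b k"] by simp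
    ultimately show "integrable M (\<lambda>\<omega>. h k (X k \<omega>))" "integrable M (\<lambda>\<omega>. (h k (X k \<omega>))\<^sup>2)"
      using that by (auto intro: integrable_const_bound[of _ "b k"] integrable_const_bound[of _ "(b k)\<^sup>2"])
  qed
  have outside: "h k y = 0" "e k = 0" "Y k \<omega> = 0" if "k \<notin> T" for k y \<omega>
    using that by (auto simp: h_def e_def Y_def)

  \<comment> \<open>Up to a constant, \<open>u k\<close> bounds the variance of each summand, as \<open>b k powr (2 - \<alpha>) / (b k)\<^sup>2 = u k\<close>.\<close>
  have noise: "AE \<omega> in M. (\<lambda>n. (\<Sum>k\<le>n. Y k \<omega>) / b n) \<longlonglongrightarrow> 0"
  proof -
    define Z where "Z i \<omega> = Y (Suc i) \<omega> / b (Suc i)" for i \<omega>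
    have "indep_vars (\<lambda>_. borel) (\<lambda>k \<omega>. (h k (X k \<omega>) - e k) / b k) {1..}"
      by (rule indep_vars_compose2[OF indep]) measurable
    then have indepZ: "indep_vars (\<lambda>_. borel) Z UNIV"
      unfolding Z_def[abs_def] Y_def
      by (rule indep_vars_inj_reindex[of "\<lambda>_. borel" _ _ Suc]) auto
    let ?K = "C * (2 powr \<alpha> / (1 - 2 powr (\<alpha> - real 2)))"
    have sqZ: "integrable M (\<lambda>\<omega>. (Z i \<omega>)\<^sup>2)" for i
      using h_int[of "Suc i"] by (simp add: Z_def Y_def power_divide power2_diff)
    have meanZ: "expectation (Z i) = 0" for i
      using h_int[of "Suc i"] by (simp add: Z_def[abs_def] Y_def e_def prob_space)
    have varZ: "expectation (\<lambda>\<omega>. (Z i \<omega>)\<^sup>2) \<le> ?K * u (Suc i)" for i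
    proof (cases "Suc i \<in> T")
      case True
      let ?k = "Suc i"
      have "expectation (\<lambda>\<omega>. (Y ?k \<omega>)\<^sup>2) = expectation (\<lambda>\<omega>. (h ?k (X ?k \<omega>))\<^sup>2) - (e ?k)\<^sup>2"
        using variance_eq[OF h_int[of ?k]] by (simp add: Y_def e_def)
      also have "\<dots> \<le> expectation (\<lambda>\<omega>. (h ?k (X ?k \<omega>))\<^sup>2)" by simp
      also have "\<dots> = expectation (\<lambda>\<omega>. if \<bar>X ?k \<omega>\<bar> \<le> b ?k then \<bar>X ?k \<omega>\<bar> ^ 2 else 0)"
        using True by (intro Bochner_Integration.integral_cong) (auto simp: h_def)
      also have "\<dots> \<le> C * (2 powr \<alpha> / (1 - 2 powr (\<alpha> - real 2)) * b ?k powr (real 2 - \<alpha>))"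
        by (rule truncated_moment_bound[OF XT(1)[OF True] tail[OF True] _ _ bpos[OF True]]) (use \<alpha> in auto)
      also have "\<dots> = ?K * u ?k * (b ?k)\<^sup>2"
      proof -
        have "b ?k powr (real 2 - \<alpha>) = u ?k * (b ?k)\<^sup>2"
          using bpos[OF True] by (simp add: b_powr[OF True, symmetric] powr_diff powr_minus powr_numeral field_simps)
        then show ?thesis by simp
      qed
      finally have "expectation (\<lambda>\<omega>. (Y ?k \<omega>)\<^sup>2) \<le> ?K * u ?k * (b ?k)\<^sup>2" .
      then show ?thesis using bpos[OF True] by (simp add: Z_def power_divide pos_divide_le_eq)
    qed (simp add: Z_def outside u_def)
    have "summable (\<lambda>i. ?K * u (Suc i))" using u by (intro summable_mult) (simp add: summable_Suc_iff)
    then have "summable (\<lambda>i. expectation (\<lambda>\<omega>. (Z i \<omega>)\<^sup>2))"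
      by (rule summable_comparison_test_ev[rotated]) (use varZ in auto)
    from kolmogorov_convergence[OF indepZ sqZ meanZ this] show ?thesis
    proof eventually_elim
      case (elim \<omega>)
      then have "summable (\<lambda>k. Y k \<omega> / b k)" unfolding Z_def by (subst (asm) summable_Suc_iff)
      from kronecker[OF mono_b b0 b_lim this]
      moreover have "b k * (Y k \<omega> / b k) = Y k \<omega>" for k using bpos[of k] outside[of k] by (cases "k \<in> T") auto
      ultimately show ?case by simp
    qed
  qed

  have abs_e: "\<bar>e k\<bar> \<le> expectation (\<lambda>\<omega>. if \<bar>X k \<omega>\<bar> \<le> b k then \<bar>X k \<omega>\<bar> else 0)" if "k \<in> T" for k
  proof -
    have "\<bar>e k\<bar> \<le> expectation (\<lambda>\<omega>. \<bar>h k (X k \<omega>)\<bar>)" unfolding e_def by (rule integral_abs_bound)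
    also have "\<dots> = expectation (\<lambda>\<omega>. if \<bar>X k \<omega>\<bar> \<le> b k then \<bar>X k \<omega>\<bar> else 0)"
      using that by (intro Bochner_Integration.integral_cong) (auto simp: h_def)
    finally show ?thesis .
  qed
  have drift: "(\<lambda>n. (\<Sum>k\<le>n. e k) / b n) \<longlonglongrightarrow> 0"
  proof (cases "\<alpha> = 1")
    case False
    have "\<exists>K. \<forall>k\<in>T. \<bar>e k\<bar> \<le> K * b k powr (1 - \<alpha>)"
    proof (cases "\<alpha> < 1")
      case True
      show ?thesis
      proof (intro exI ballI)
        fix k assume k: "k \<in> T"
        show "\<bar>e k\<bar> \<le> C * (2 powr \<alpha> / (1 - 2 powr (\<alpha> - real 1))) * b k powr (1 - \<alpha>)"
          using truncated_moment_bound[OF XT(1)[OF k] tail[OF k] _ _ bpos[OF k], of 1, unfolded power_one_right] abs_e[OF k] True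
          by (simp add: mult.assoc)
      qed
    next
      case False
      with \<open>\<alpha> \<noteq> 1\<close> have \<alpha>1: "1 < \<alpha>" by simp
      show ?thesis
      proof (intro exI ballI)
        fix k assume k: "k \<in> T"
        note [measurable] = XT(1)[OF k]
        note tb = tail_moment_bound[OF XT(1)[OF k] tail[OF k] \<alpha>1 bpos[OF k]]
        have int: "integrable M (\<lambda>\<omega>. X k \<omega> - h k (X k \<omega>))"
          by (rule Bochner_Integration.integrable_bound[OF tb(1)]) (use k in \<open>auto simp: h_def\<close>)
        have "e k = - expectation (\<lambda>\<omega>. X k \<omega> - h k (X k \<omega>))"
        proof -
          have "expectation (X k) = expectation (\<lambda>\<omega>. (X k \<omega> - h k (X k \<omega>)) + h k (X k \<omega>))" by simp
          also have "\<dots> = expectation (\<lambda>\<omega>. X k \<omega> - h k (X k \<omega>)) + e k"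
            unfolding e_def using int h_int(1)[OF XT(2)[OF k]] by (rule Bochner_Integration.integral_add)
          finally show ?thesis using centred[OF \<alpha>1 k] by simp
        qed
        also have "\<bar>\<dots>\<bar> \<le> expectation (\<lambda>\<omega>. \<bar>X k \<omega> - h k (X k \<omega>)\<bar>)" by (simp add: integral_abs_bound)
        also have "\<dots> = expectation (\<lambda>\<omega>. if b k < \<bar>X k \<omega>\<bar> then \<bar>X k \<omega>\<bar> else 0)"
          using k by (intro Bochner_Integration.integral_cong) (auto simp: h_def)
        also note tb(2)
        finally show "\<bar>e k\<bar> \<le> C * (2 / (1 - 2 powr (1 - \<alpha>))) * b k powr (1 - \<alpha>)" by (simp add: mult.assoc)
      qed
    qed
    then obtain K where K: "\<And>k. k \<in> T \<Longrightarrow> \<bar>e k\<bar> \<le> K * b k powr (1 - \<alpha>)" by blast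
    have le: "\<bar>e k\<bar> \<le> b k * (K * u k)" for k
    proof (cases "k \<in> T")
      case True
      have "b k powr (1 - \<alpha>) = b k * u k"
        using bpos[OF True] by (simp add: b_powr[OF True, symmetric] powr_diff powr_minus field_simps)
      then show ?thesis using K[OF True] by (simp add: mult_ac)
    qed (simp add: outside u_def)
    have "(\<lambda>n. (\<Sum>k\<le>n. b k * (K * u k)) / b n) \<longlonglongrightarrow> 0"
      by (rule kronecker[OF mono_b b0 b_lim summable_mult[OF u]])
    then show ?thesis
    proof (rule Lim_null_comparison[rotated], intro always_eventually allI)
      fix n
      have "\<bar>\<Sum>k\<le>n. e k\<bar> \<le> (\<Sum>k\<le>n. b k * (K * u k))"
        by (rule order_trans[OF sum_abs sum_mono]) (rule le)
      then show "norm ((\<Sum>k\<le>n. e k) / b n) \<le> (\<Sum>k\<le>n. b k * (K * u k)) / b n"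
        by (simp add: b0 divide_right_mono)
    qed
  next
    case True
    note g_lim = divergent_weight_at_top[OF T inf g sum]
    have b1: "b n = real (cnt T n) * g n" for n using g(2)[of n] True by (simp add: b_def)
    \<comment> \<open>All means up to \<open>n\<close> are at most \<open>?L n = O(ln (b n))\<close>, and \<open>b n = cnt T n * g n\<close>, so it suffices
      that \<open>?L n\<close> is \<open>o(g n)\<close>.\<close>
    let ?L = "\<lambda>n. 1 + C * (2 * (log 2 (max 1 (b n)) + 1))"
    have le: "\<bar>e k\<bar> \<le> ?L n" if k: "k \<in> T" and kn: "k \<le> n" for k n
    proof -
      note [measurable] = XT(1)[OF k]
      have "\<bar>e k\<bar> \<le> expectation (\<lambda>\<omega>. if \<bar>X k \<omega>\<bar> \<le> b k then \<bar>X k \<omega>\<bar> else 0)" by (rule abs_e[OF k])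
      also have "\<dots> \<le> expectation (\<lambda>\<omega>. if \<bar>X k \<omega>\<bar> \<le> max 1 (b n) then \<bar>X k \<omega>\<bar> else 0)"
      proof (rule integral_mono)
        show "integrable M (\<lambda>\<omega>. if \<bar>X k \<omega>\<bar> \<le> b k then \<bar>X k \<omega>\<bar> else 0)"
          by (rule integrable_const_bound[of _ "b k"]) (auto simp: b0)
        show "integrable M (\<lambda>\<omega>. if \<bar>X k \<omega>\<bar> \<le> max 1 (b n) then \<bar>X k \<omega>\<bar> else 0)"
          by (rule integrable_const_bound[of _ "max 1 (b n)"]) (auto simp: b0)
      qed (use monoD[OF mono_b kn] in auto)
      also have "\<dots> \<le> ?L n"
        by (rule truncated_mean_log_bound[OF XT(1)[OF k]]) (use tail[OF k] True in auto)
      finally show ?thesis .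
    qed
    have sum_le: "\<bar>\<Sum>k\<le>n. e k\<bar> \<le> real (cnt T n) * ?L n" for n
    proof -
      have "e k = 0" if "k \<in> {..n} - T \<inter> {1..n}" for k
        using that XT(2)[of k] outside(2)[of k] by auto
      then have "sum e {..n} = sum e (T \<inter> {1..n})" by (intro sum.mono_neutral_right[OF finite_atMost] ballI) fastforce+
      then have "\<bar>\<Sum>k\<le>n. e k\<bar> = \<bar>\<Sum>k\<in>T \<inter> {1..n}. e k\<bar>" by simp
      also have "\<dots> \<le> (\<Sum>k\<in>T \<inter> {1..n}. ?L n)"
      proof (rule order_trans[OF sum_abs sum_mono])
        fix k assume "k \<in> T \<inter> {1..n}"
        then show "\<bar>e k\<bar> \<le> ?L n" by (intro le) auto
      qed
      finally show ?thesis by (simp only: cnt_def sum_constant)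
    qed
    have "eventually (\<lambda>n. 1 \<le> cnt T n) sequentially" using inf unfolding filterlim_at_top by blast
    then obtain N where "1 \<le> cnt T N" unfolding eventually_sequentially by blast
    then have "T \<noteq> {}" by (intro notI) (simp add: cnt_def)
    then obtain k0 where k0: "k0 \<in> T" by blast
    have "(\<lambda>n. ?L n / g n) \<longlonglongrightarrow> 0"
    proof (rule Lim_null_comparison)
      show "(\<lambda>n. (1 + 2 * C) * (1 / g n) + 2 * C / ln 2 * (harm (cnt T n) / g n) + 2 * C / ln 2 * (ln (g n) / g n)) \<longlonglongrightarrow> 0"
      proof (intro tendsto_add_zero tendsto_mult_right_zero)
        show "(\<lambda>n. harm (cnt T n) / g n) \<longlonglongrightarrow> 0" by (rule g_lim(2))
        show "(\<lambda>n. 1 / g n) \<longlonglongrightarrow> 0"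
          by (rule tendsto_divide_0[OF tendsto_const filterlim_at_top_imp_at_infinity[OF g_lim(1)]])
        show "(\<lambda>n. ln (g n) / g n) \<longlonglongrightarrow> 0"
        proof (rule filterlim_compose[OF _ g_lim(1)])
          show "((\<lambda>x::real. ln x / x) \<longlongrightarrow> 0) at_top" by real_asymp
        qed
      qed
      have "eventually (\<lambda>n. 1 \<le> g n) sequentially" using g_lim(1) by (auto simp: filterlim_at_top)
      moreover have "eventually (\<lambda>n. 1 \<le> cnt T n) sequentially" using inf by (auto simp: filterlim_at_top)
      ultimately show "eventually (\<lambda>n. norm (?L n / g n) \<le> (1 + 2 * C) * (1 / g n) + 2 * C / ln 2 * (harm (cnt T n) / g n) + 2 * C / ln 2 * (ln (g n) / g n)) sequentially"
      proof eventually_elim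
        case (elim n)
        have "1 \<le> b n" unfolding b1 using mult_mono[of 1 "real (cnt T n)" 1 "g n"] elim by simp
        then have "log 2 (max 1 (b n)) = ln (real (cnt T n)) / ln 2 + ln (g n) / ln 2"
          using elim by (simp add: b1 log_def ln_mult add_divide_distrib max_def)
        moreover have "ln (real (cnt T n)) \<le> harm (cnt T n)"
          using elim by (intro order_trans[OF _ harm_ge_ln]) simp
        ultimately have "log 2 (max 1 (b n)) \<le> harm (cnt T n) / ln 2 + ln (g n) / ln 2"
          by (simp add: divide_right_mono)
        then have "?L n \<le> 1 + C * (2 * (harm (cnt T n) / ln 2 + ln (g n) / ln 2 + 1))"
          using C[OF k0] by (intro add_left_mono mult_left_mono) auto
        moreover have "0 \<le> ?L n" using C[OF k0] by (auto intro!: add_nonneg_nonneg mult_nonneg_nonneg)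
        ultimately have "norm (?L n / g n) \<le> (1 + C * (2 * (harm (cnt T n) / ln 2 + ln (g n) / ln 2 + 1))) / g n"
          using elim by (simp add: divide_right_mono)
        also have "\<dots> = (1 + 2 * C) * (1 / g n) + 2 * C / ln 2 * (harm (cnt T n) / g n) + 2 * C / ln 2 * (ln (g n) / g n)"
          by (simp add: add_divide_distrib distrib_left distrib_right mult_ac)
        finally show ?case .
      qed
    qed
    then show ?thesis
    proof (rule Lim_null_comparison[rotated])
      have "eventually (\<lambda>n. 1 \<le> cnt T n) sequentially" using inf by (auto simp: filterlim_at_top)
      then show "eventually (\<lambda>n. norm ((\<Sum>k\<le>n. e k) / b n) \<le> ?L n / g n) sequentially"
      proof eventually_elim
        case (elim n)
        have "norm ((\<Sum>k\<le>n. e k) / b n) \<le> real (cnt T n) * ?L n / b n"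
          using sum_le[of n] b0[of n] by (simp add: divide_right_mono)
        also have "\<dots> = ?L n / g n" unfolding b1 using elim g(2)[of n] by simp
        finally show ?case .
      qed
    qed
  qed

  define d where "d k \<omega> = (if k \<in> T then X k \<omega> else 0) - h k (X k \<omega>)" for k \<omega>
  have large: "AE \<omega> in M. (\<lambda>n. (\<Sum>k\<le>n. d k \<omega>) / b n) \<longlonglongrightarrow> 0"
  proof -
    let ?A = "\<lambda>k. if k \<in> T then {\<omega>\<in>space M. b k < \<bar>X k \<omega>\<bar>} else {}"
    have A: "?A k \<in> sets M" for k using XT[of k] by auto
    have finA: "emeasure M (?A k) < \<infinity>" for k by (simp only: emeasure_eq_measure infinity_ennreal_def ennreal_less_top)
    have "prob (?A k) \<le> C * u k" for k
      using tail[OF _ bpos, of k k] b_powr[of k] by (auto simp: u_def)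
    then have "summable (\<lambda>k. prob (?A k))"
      by (intro summable_comparison_test_ev[OF _ summable_mult[OF u, of C]]) auto
    from borel_cantelli_AE1[OF A finA this] show ?thesis
    proof (eventually_elim)
      case (elim \<omega>)
      then have "eventually (\<lambda>k. d k \<omega> / b k = 0) sequentially"
        by eventually_elim (auto simp: d_def h_def split: if_splits)
      then have "summable (\<lambda>k. d k \<omega> / b k)" using summable_cong[of "\<lambda>k. d k \<omega> / b k" "\<lambda>_. 0"] by simp
      note kronecker[OF mono_b b0 b_lim this]
      moreover have "b k * (d k \<omega> / b k) = d k \<omega>" for k
        using bpos[of k] outside(1)[of k] by (cases "k \<in> T") (auto simp: d_def)
      ultimately show ?case by simp
    qed
  qed

  from noise large show ?thesis
  proof eventually_elim
    case (elim \<omega>)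
    have "(\<Sum>k\<in>T \<inter> {1..n}. X k \<omega>) = (\<Sum>k\<le>n. Y k \<omega>) + (\<Sum>k\<le>n. e k) + (\<Sum>k\<le>n. d k \<omega>)" for n
    proof -
      have "(\<Sum>k\<in>T \<inter> {1..n}. X k \<omega>) = (\<Sum>k\<in>T \<inter> {1..n}. if k \<in> T then X k \<omega> else 0)"
        by (rule sum.cong) auto
      also have "\<dots> = (\<Sum>k\<le>n. if k \<in> T then X k \<omega> else 0)"
        using T by (intro sum.mono_neutral_left) (auto simp: Suc_le_eq)
      also have "\<dots> = (\<Sum>k\<le>n. Y k \<omega> + e k + d k \<omega>)" by (simp add: Y_def d_def)
      finally show ?thesis by (simp add: sum.distrib)
    qed
    then show ?case
      using tendsto_add[OF tendsto_add[OF elim(1) drift] elim(2)] by (simp add: b_def[symmetric] add_divide_distrib)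
  qed
qed

section \<open>The mean of an uncentred class\<close>

text \<open>With a slowly growing \<open>g\<close>, \<open>class_sum_negligible\<close> becomes a strong law for the class:
  the averages converge to \<open>e\<close>. If \<open>e\<close> were nonzero, the sums normalized by the smaller power
  \<open>cnt T n powr (1 / \<alpha>)\<close> would escape to infinity almost surely, so no mass would be left for the weak
  limit; the test function \<open>1 / (1 + x\<^sup>2)\<close> detects this for either sign of \<open>e\<close>.\<close>

lemma mean_zero_if_weakly_convergent:
  fixes X :: "nat \<Rightarrow> 'a \<Rightarrow> real"
  assumes indep: "indep_vars (\<lambda>_. borel) X {1..}"
    and T: "T \<subseteq> {1..}" and inf: "filterlim (cnt T) at_top sequentially"
    and \<alpha>: "1 < \<alpha>" "\<alpha> < 2"
    and tail: "\<And>k x. k \<in> T \<Longrightarrow> 0 < x \<Longrightarrow> prob {\<omega>\<in>space M. x < \<bar>X k \<omega>\<bar>} \<le> C * x powr - \<alpha>"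
    and mean: "\<And>k. k \<in> T \<Longrightarrow> expectation (X k) = e"
    and L: "real_distribution L"
    and conv: "weak_conv_m (\<lambda>n. distr M borel (\<lambda>\<omega>. (\<Sum>k\<in>T \<inter> {1..n}. X k \<omega>) / real (cnt T n) powr (1 / \<alpha>))) L"
  shows "e = 0"
proof (rule ccontr)
  assume e: "e \<noteq> 0"
  have Xm[measurable]: "X k \<in> borel_measurable M" if "1 \<le> k" for k using indep that by (auto simp: indep_vars_def)
  have XT: "X k \<in> borel_measurable M" "1 \<le> k" if "k \<in> T" for k using Xm T that by auto
  \<comment> \<open>Any power of the logarithm above the first makes the series converge and is negligible against
    the power of \<open>cnt T n\<close> gained from \<open>\<alpha> > 1\<close>. It depends on \<open>cnt T n\<close>, not on \<open>n\<close>, since \<open>T\<close> may be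
    arbitrarily sparse.\<close>
  define g where "g n = (1 + ln (real (max 1 (cnt T n)))) powr (1 + 1)" for n
  have g: "mono g" "\<And>n. 0 < g n"
  proof -
    show "mono g"
    proof (rule monoI)
      fix m n :: nat assume "m \<le> n"
      then have "cnt T m \<le> cnt T n" by (rule monoD[OF mono_cnt])
      then show "g m \<le> g n" unfolding g_def by (intro powr_mono2 add_left_mono ln_mono) (auto simp: max_def)
    qed
    show "0 < g n" for n
      unfolding g_def by (simp add: add_pos_nonneg less_imp_neq[symmetric])
  qed
  let ?U = "\<lambda>n \<omega>. \<Sum>k\<in>T \<inter> {1..n}. X k \<omega>"
  have "AE \<omega> in M. (\<lambda>n. (\<Sum>k\<in>T \<inter> {1..n}. X k \<omega> - e) / (real (cnt T n) * g n) powr (1 / \<alpha>)) \<longlonglongrightarrow> 0"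
  proof (rule class_sum_negligible[OF _ T inf _ _ _ _ g])
    show "indep_vars (\<lambda>_. borel) (\<lambda>k \<omega>. X k \<omega> - e) {1..}"
      by (rule indep_vars_compose2[OF indep]) measurable
    show "0 < \<alpha>" "\<alpha> < 2" using \<alpha> by auto
    show "prob {\<omega>\<in>space M. x < \<bar>X k \<omega> - e\<bar>} \<le> (C * 2 powr \<alpha> + (2 * \<bar>e\<bar>) powr \<alpha>) * x powr - \<alpha>"
      if k: "k \<in> T" and x: "0 < x" for k x
    proof (cases "x \<le> 2 * \<bar>e\<bar>")
      case True
      have C: "0 \<le> C" using order_trans[OF measure_nonneg tail[OF k, of 1]] by simp
      have "prob {\<omega>\<in>space M. x < \<bar>X k \<omega> - e\<bar>} \<le> 1" by simp
      also have "1 \<le> ((2 * \<bar>e\<bar>) powr \<alpha>) * x powr - \<alpha>"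
        using True x \<alpha> powr_mono2[of \<alpha> x "2 * \<bar>e\<bar>"] by (simp add: powr_minus field_simps)
      also have "\<dots> \<le> (C * 2 powr \<alpha> + (2 * \<bar>e\<bar>) powr \<alpha>) * x powr - \<alpha>"
        using C by (intro mult_right_mono) auto
      finally show ?thesis .
    next
      case False
      have "prob {\<omega>\<in>space M. x < \<bar>X k \<omega> - e\<bar>} \<le> prob {\<omega>\<in>space M. x / 2 < \<bar>X k \<omega>\<bar>}"
      proof (rule finite_measure_mono)
        show "{\<omega>\<in>space M. x < \<bar>X k \<omega> - e\<bar>} \<subseteq> {\<omega>\<in>space M. x / 2 < \<bar>X k \<omega>\<bar>}"
          using False by auto
        show "{\<omega>\<in>space M. x / 2 < \<bar>X k \<omega>\<bar>} \<in> events" using XT[OF k] by auto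
      qed
      also have "\<dots> \<le> C * (x / 2) powr - \<alpha>" using x by (intro tail[OF k]) auto
      also have "\<dots> = C * 2 powr \<alpha> * x powr - \<alpha>"
        using x by (simp add: powr_divide powr_minus field_simps)
      also have "\<dots> \<le> (C * 2 powr \<alpha> + (2 * \<bar>e\<bar>) powr \<alpha>) * x powr - \<alpha>"
        by (intro mult_right_mono) auto
      finally show ?thesis .
    qed
    show "expectation (\<lambda>\<omega>. X k \<omega> - e) = 0" if k: "k \<in> T" for k
    proof -
      have "integrable M (X k)"
      proof (rule Bochner_Integration.integrable_bound)
        show "integrable M (\<lambda>\<omega>. 1 + (if 1 < \<bar>X k \<omega>\<bar> then \<bar>X k \<omega>\<bar> else 0))"
          using tail_moment_bound(1)[OF XT(1)[OF k] tail[OF k] \<alpha>(1), of 1] by simp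
      qed (use XT[OF k] in auto)
      then show ?thesis using mean[OF k] by (simp add: prob_space)
    qed
    have "summable (\<lambda>j. 1 / (real j * (1 + ln (real (max 1 j))) powr (1 + 1)))"
      by (rule summable_inverse_mult_ln_powr) simp
    from summable_over_cnt[OF T this] have "summable (\<lambda>k. if k \<in> T
        then 1 / (real (cnt T k) * (1 + ln (real (max 1 (cnt T k)))) powr (1 + 1)) else 0)" by simp
    then show "summable (\<lambda>k. if k \<in> T then 1 / (real (cnt T k) * g k) else 0)"
      by (simp only: g_def)
  qed
  \<comment> \<open>The averages tend to \<open>e \<noteq> 0\<close>, and the normalized sum is the average times \<open>cnt T n powr (1 - 1 / \<alpha>)\<close>.\<close>
  then have diverge: "AE \<omega> in M. filterlim (\<lambda>n. \<bar>?U n \<omega> / real (cnt T n) powr (1 / \<alpha>)\<bar>) at_top sequentially"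
  proof eventually_elim
    case (elim \<omega>)
    have rate: "((\<lambda>x::real. (x * (1 + ln x) powr 2) powr (1 / \<alpha>) / x) \<longlongrightarrow> 0) at_top"
    proof -
      have "1 / \<alpha> - 1 < 0" using \<alpha> by simp
      then have "((\<lambda>x::real. x powr (1 / \<alpha> - 1) * (1 + ln x) powr (2 / \<alpha>)) \<longlongrightarrow> 0) at_top" by real_asymp
      moreover have "eventually (\<lambda>x::real. x powr (1 / \<alpha> - 1) * (1 + ln x) powr (2 / \<alpha>)
          = (x * (1 + ln x) powr 2) powr (1 / \<alpha>) / x) at_top"
        using eventually_ge_at_top[of 1]
      proof eventually_elim
        case (elim x)
        then show ?case using powr_powr[of "1 + ln x" 2 "1 / \<alpha>"] by (simp add: powr_mult powr_diff)
      qed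
      ultimately show ?thesis by (rule Lim_transform_eventually)
    qed
    have cnt_real: "filterlim (\<lambda>n. real (cnt T n)) at_top sequentially"
      by (rule filterlim_compose[OF filterlim_real_sequentially inf])
    have cnt1: "eventually (\<lambda>n. 1 \<le> cnt T n) sequentially" using inf unfolding filterlim_at_top by blast
    have "(\<lambda>n. (\<Sum>k\<in>T \<inter> {1..n}. X k \<omega> - e) / (real (cnt T n) * g n) powr (1 / \<alpha>) *
        ((real (cnt T n) * (1 + ln (real (cnt T n))) powr 2) powr (1 / \<alpha>) / real (cnt T n)) + e) \<longlonglongrightarrow> 0 * 0 + e"
      by (intro tendsto_intros elim filterlim_compose[OF rate cnt_real])
    moreover have "eventually (\<lambda>n. (\<Sum>k\<in>T \<inter> {1..n}. X k \<omega> - e) / (real (cnt T n) * g n) powr (1 / \<alpha>) *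
        ((real (cnt T n) * (1 + ln (real (cnt T n))) powr 2) powr (1 / \<alpha>) / real (cnt T n)) + e
        = ?U n \<omega> / real (cnt T n)) sequentially"
      using cnt1
    proof eventually_elim
      case (elim n)
      have "g n = (1 + ln (real (cnt T n))) powr 2" using elim by (simp add: g_def max_def)
      moreover have "1 + ln (real (cnt T n)) \<noteq> 0" using elim ln_ge_zero[of "real (cnt T n)"] by linarith
      moreover have "(\<Sum>k\<in>T \<inter> {1..n}. X k \<omega> - e) = ?U n \<omega> - real (cnt T n) * e"
        by (simp add: sum_subtractf cnt_def)
      ultimately show ?case using elim by (simp add: field_simps)
    qed
    ultimately have "(\<lambda>n. ?U n \<omega> / real (cnt T n)) \<longlonglongrightarrow> 0 * 0 + e" by (rule Lim_transform_eventually)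
    then have "(\<lambda>n. \<bar>?U n \<omega> / real (cnt T n)\<bar>) \<longlonglongrightarrow> \<bar>e\<bar>" by (intro tendsto_rabs) simp
    moreover have "filterlim (\<lambda>n. real (cnt T n) powr (1 - 1 / \<alpha>)) at_top sequentially"
    proof (rule filterlim_compose[OF _ cnt_real])
      have "0 < 1 - 1 / \<alpha>" using \<alpha> by simp
      then show "filterlim (\<lambda>x::real. x powr (1 - 1 / \<alpha>)) at_top at_top" by real_asymp
    qed
    ultimately have "filterlim (\<lambda>n. \<bar>?U n \<omega> / real (cnt T n)\<bar> * real (cnt T n) powr (1 - 1 / \<alpha>)) at_top sequentially"
      using e by (intro filterlim_tendsto_pos_mult_at_top[where c="\<bar>e\<bar>"]) auto
    moreover have "eventually (\<lambda>n. \<bar>?U n \<omega> / real (cnt T n)\<bar> * real (cnt T n) powr (1 - 1 / \<alpha>)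
        = \<bar>?U n \<omega> / real (cnt T n) powr (1 / \<alpha>)\<bar>) sequentially"
      using cnt1 by eventually_elim (simp add: powr_diff)
    ultimately show ?case by (rule filterlim_cong[THEN iffD1, OF refl refl, rotated])
  qed
  let ?Z = "\<lambda>n \<omega>. ?U n \<omega> / real (cnt T n) powr (1 / \<alpha>)"
  let ?h = "\<lambda>x::real. 1 / (1 + x\<^sup>2)"
  have Um[measurable]: "?U n \<in> borel_measurable M" for n by (intro borel_measurable_sum XT) auto
  interpret L: real_distribution L by fact
  have hbound: "norm (?h x) \<le> 1" for x by (simp add: add_pos_nonneg)
  have den: "1 + x\<^sup>2 \<noteq> 0" for x :: real by (smt (verit) zero_le_power2)
  have "(\<lambda>n. integral\<^sup>L (distr M borel (?Z n)) ?h) \<longlonglongrightarrow> integral\<^sup>L L ?h"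
  proof (rule weak_conv_imp_integral_bdd_continuous_conv[OF _ L conv])
    show "real_distribution (distr M borel (?Z n))" for n by (intro real_distribution_distr) simp
    show "isCont ?h x" for x using den by (intro continuous_intros) auto
  qed (rule hbound)
  moreover have "integral\<^sup>L (distr M borel (?Z n)) ?h = expectation (\<lambda>\<omega>. ?h (?Z n \<omega>))" for n
    by (rule integral_distr) auto
  moreover have "(\<lambda>n. expectation (\<lambda>\<omega>. ?h (?Z n \<omega>))) \<longlonglongrightarrow> expectation (\<lambda>\<omega>. 0)"
  proof (rule integral_dominated_convergence[where w="\<lambda>_. 1"])
    show "AE \<omega> in M. (\<lambda>n. ?h (?Z n \<omega>)) \<longlonglongrightarrow> 0" using diverge
    proof eventually_elim
      case (elim \<omega>)
      have "((\<lambda>x::real. ?h x) \<longlongrightarrow> 0) at_top" by real_asymp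
      from filterlim_compose[OF this elim] show ?case by (simp only: power2_abs)
    qed
    show "AE \<omega> in M. norm (?h (?Z n \<omega>)) \<le> 1" for n using hbound by blast
  qed auto
  ultimately have "integral\<^sup>L L ?h = 0" using LIMSEQ_unique by fastforce
  moreover have "integrable L ?h" by (rule L.integrable_const_bound[of _ 1]) (use hbound in auto)
  ultimately have "AE x in L. ?h x = 0" by (subst (asm) integral_nonneg_eq_0_iff_AE) auto
  then have "AE x in L. False" by eventually_elim (use den in auto)
  then show False by simp
qed

section \<open>Divergent series: recurrent large jumps\<close>

end

lemma limsup_eq_infinity:
  fixes x :: "nat \<Rightarrow> real"
  assumes "\<And>K::nat. frequently (\<lambda>n. real K \<le> x n) sequentially"
  shows "limsup (\<lambda>n. ereal (x n)) = \<infinity>"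
proof (rule ccontr)
  assume "limsup (\<lambda>n. ereal (x n)) \<noteq> \<infinity>"
  then obtain K :: nat where "limsup (\<lambda>n. ereal (x n)) < ereal (real K)"
    by (auto simp: less_PInf_Ex_of_nat)
  from Limsup_lessD[OF this] have "eventually (\<lambda>n. \<not> real K \<le> x n) sequentially"
    by eventually_elim simp
  with assms[of K] show False by (simp add: frequently_def)
qed

context prob_space
begin

text \<open>Independence turns the probability that no event occurs after \<open>N\<close> into a product, which is at most the
  exponential of minus a divergent sum.\<close>

lemma borel_cantelli_independent:
  fixes X :: "nat \<Rightarrow> 'a \<Rightarrow> real"
  assumes indep: "indep_vars (\<lambda>_. borel) X UNIV"
    and D: "\<And>k. D k \<in> sets borel"
    and div: "\<not> summable (\<lambda>k. prob {\<omega>\<in>space M. X k \<omega> \<in> D k})"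
  shows "AE \<omega> in M. frequently (\<lambda>k. X k \<omega> \<in> D k) sequentially"
proof -
  have [measurable]: "\<And>k. X k \<in> borel_measurable M" using indep by (auto simp: indep_vars_def)
  note [measurable] = D
  let ?p = "\<lambda>k. prob {\<omega>\<in>space M. X k \<omega> \<in> D k}"
  let ?E = "\<lambda>N. {\<omega>\<in>space M. \<forall>k\<ge>N. X k \<omega> \<notin> D k}"
  have "AE \<omega> in M. \<omega> \<notin> ?E N" for N
  proof -
    have "\<not> summable (\<lambda>k. ?p (k + N))" using div by (subst summable_iff_shift)
    then have unb: "\<exists>n. B < (\<Sum>k<n. ?p (k + N))" for B
      using summableI_nonneg_bounded[of "\<lambda>k. ?p (k + N)" B] by (auto simp: not_le[symmetric])
    have le: "prob (?E N) \<le> exp (- (\<Sum>k<n. ?p (k + N)))" for n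
    proof -
      let ?I = "(\<lambda>k. k + N) ` {..<Suc n}"
      have "prob (?E N) \<le> prob (\<Inter>k\<in>?I. X k -` (- D k) \<inter> space M)"
        by (intro finite_measure_mono) auto
      also have "\<dots> = (\<Prod>k\<in>?I. prob (X k -` (- D k) \<inter> space M))"
        by (intro indep_varsD_finite[OF indep_vars_subset[OF indep]]) auto
      also have "\<dots> = (\<Prod>k<Suc n. prob (X (k + N) -` (- D (k + N)) \<inter> space M))"
        by (subst prod.reindex) (auto simp: inj_on_def)
      also have "\<dots> \<le> (\<Prod>k<Suc n. exp (- ?p (k + N)))"
      proof (intro prod_mono conjI)
        fix k
        have "prob (X (k + N) -` (- D (k + N)) \<inter> space M) = prob (space M - {\<omega>\<in>space M. X (k + N) \<omega> \<in> D (k + N)})"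
          by (intro arg_cong[where f=prob]) auto
        also have "\<dots> = 1 - ?p (k + N)" by (rule prob_compl) simp
        also have "\<dots> \<le> exp (- ?p (k + N))" using exp_ge_add_one_self[of "- ?p (k + N)"] by simp
        finally show "prob (X (k + N) -` (- D (k + N)) \<inter> space M) \<le> exp (- ?p (k + N))" .
      qed simp
      also have "\<dots> = exp (- (\<Sum>k<Suc n. ?p (k + N)))" by (simp add: exp_sum sum_negf[symmetric] del: sum.lessThan_Suc prod.lessThan_Suc)
      also have "\<dots> \<le> exp (- (\<Sum>k<n. ?p (k + N)))" by simp
      finally show ?thesis .
    qed
    have "prob (?E N) \<le> 0"
    proof (rule field_le_epsilon)
      fix r :: real assume r: "0 < r"
      obtain n where "- ln r < (\<Sum>k<n. ?p (k + N))" using unb by blast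
      then have "exp (- (\<Sum>k<n. ?p (k + N))) \<le> exp (ln r)" by (subst exp_le_cancel_iff) linarith
      then show "prob (?E N) \<le> 0 + r" using le[of n] r by simp
    qed
    then have "prob (?E N) = 0" by (simp add: measure_le_0_iff)
    then show ?thesis by (subst (asm) prob_eq_0) auto
  qed
  then have "AE \<omega> in M. \<forall>N. \<omega> \<notin> ?E N" by (simp add: AE_all_countable)
  with AE_space show ?thesis
    by eventually_elim (auto simp: frequently_sequentially)
qed

text \<open>The divergent half. The sums run over all indices, not only over \<open>T\<close>: a jump at an index of \<open>T\<close> by more
  than \<open>2 * K\<close> times the normalization forces one of the two sums next to it above \<open>K\<close> times its own.\<close>

lemma limsup_partial_sums_infinite:
  fixes X :: "nat \<Rightarrow> 'a \<Rightarrow> real" and g a :: "nat \<Rightarrow> real"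
  assumes indep: "indep_vars (\<lambda>_. borel) X {1..}"
    and T: "T \<subseteq> {1..}" and inf: "filterlim (cnt T) at_top sequentially" and \<alpha>: "0 < \<alpha>"
    and c: "0 < c" and tail: "\<And>k x. k \<in> T \<Longrightarrow> x0 \<le> x \<Longrightarrow> c * x powr - \<alpha> \<le> prob {\<omega>\<in>space M. x < \<bar>X k \<omega>\<bar>}"
    and g: "mono g" "\<And>n. 0 < g n"
    and div: "\<not> summable (\<lambda>k. if k \<in> T then 1 / (real (cnt T k) * g k) else 0)"
    and a_pos: "eventually (\<lambda>n. 0 < a n) sequentially"
    and a_mono: "eventually (\<lambda>n. a n \<le> a (Suc n)) sequentially"
    and D: "0 < D" and a_le: "eventually (\<lambda>n. a n \<le> D * (real (cnt T n) * g n) powr (1 / \<alpha>)) sequentially"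
  shows "AE \<omega> in M. limsup (\<lambda>n. ereal (\<bar>\<Sum>k=1..n. X k \<omega>\<bar> / a n)) = \<infinity>"
proof -
  define b where "b n = (real (cnt T n) * g n) powr (1 / \<alpha>)" for n
  define u where "u k = (if k \<in> T then 1 / (real (cnt T k) * g k) else 0)" for k
  have b_lim: "filterlim b at_top sequentially"
    unfolding b_def[abs_def] using inf \<alpha> g by (rule class_normalizer_at_top)
  have b_powr: "b k powr - \<alpha> = u k" if "k \<in> T" for k
    using cnt_pos[OF that] T g(2)[of k] \<alpha> that
    by (force simp: b_def u_def powr_powr powr_minus inverse_eq_divide)
  have jumps: "AE \<omega> in M. frequently (\<lambda>k. Suc k \<in> T \<and> K * b (Suc k) < \<bar>X (Suc k) \<omega>\<bar>) sequentially"
    if K: "0 < K" for K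
  proof -
    let ?D = "\<lambda>k. if Suc k \<in> T then {y. K * b (Suc k) < \<bar>y\<bar>} else {}"
    have "AE \<omega> in M. frequently (\<lambda>k. X (Suc k) \<omega> \<in> ?D k) sequentially"
    proof (rule borel_cantelli_independent)
      show "indep_vars (\<lambda>_. borel) (\<lambda>k. X (Suc k)) UNIV"
        by (rule indep_vars_inj_reindex[OF indep]) auto
      show "?D k \<in> sets borel" for k by auto
      show "\<not> summable (\<lambda>k. prob {\<omega>\<in>space M. X (Suc k) \<omega> \<in> ?D k})"
      proof
        assume sum: "summable (\<lambda>k. prob {\<omega>\<in>space M. X (Suc k) \<omega> \<in> ?D k})"
        have "summable (\<lambda>k. u (Suc k))"
        proof (rule summable_comparison_test_ev[OF _ summable_mult[OF sum, of "K powr \<alpha> / c"]])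
          have "eventually (\<lambda>k. x0 / K \<le> b (Suc k)) sequentially"
            using b_lim by (subst eventually_sequentially_Suc) (simp add: filterlim_at_top)
          then show "eventually (\<lambda>k. norm (u (Suc k)) \<le> K powr \<alpha> / c * prob {\<omega>\<in>space M. X (Suc k) \<omega> \<in> ?D k}) sequentially"
          proof eventually_elim
            case (elim k)
            show ?case
            proof (cases "Suc k \<in> T")
              case True
              have "c * (K * b (Suc k)) powr - \<alpha> \<le> prob {\<omega>\<in>space M. K * b (Suc k) < \<bar>X (Suc k) \<omega>\<bar>}"
                using elim K by (intro tail[OF True]) (simp add: field_simps)
              moreover have "(K * b (Suc k)) powr - \<alpha> = u (Suc k) / K powr \<alpha>"
                using K by (simp add: powr_mult b_powr[OF True]) (simp add: powr_minus b_def field_simps)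
              moreover have "0 \<le> u (Suc k)" using g(2)[of "Suc k"] by (simp add: u_def)
              ultimately show ?thesis using c K True by (simp add: field_simps)
            qed (simp add: u_def)
          qed
        qed
        then have "summable u" by (subst (asm) summable_Suc_iff)
        with div show False by (simp add: u_def[abs_def])
      qed
    qed
    then show ?thesis
      by eventually_elim (auto elim!: frequently_elim1 split: if_splits)
  qed
  have "AE \<omega> in M. \<forall>K::nat. frequently (\<lambda>k. Suc k \<in> T \<and> (2 * real (Suc K) * D) * b (Suc k) < \<bar>X (Suc k) \<omega>\<bar>) sequentially"
    unfolding AE_all_countable using D by (intro allI jumps) auto
  then show ?thesis
  proof eventually_elim
    case (elim \<omega>)
    let ?S = "\<lambda>n. \<Sum>k=1..n. X k \<omega>"
    show ?case
    proof (rule limsup_eq_infinity)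
      fix K :: nat
      let ?Q = "\<lambda>n. real K \<le> \<bar>?S n\<bar> / a n"
      have ev: "eventually (\<lambda>k. 0 < a k \<and> 0 < a (Suc k) \<and> a k \<le> a (Suc k) \<and> a (Suc k) \<le> D * b (Suc k)) sequentially"
        using a_pos a_mono a_pos[THEN eventually_sequentially_Suc[THEN iffD2]]
          a_le[THEN eventually_sequentially_Suc[THEN iffD2]] unfolding b_def[symmetric]
        by eventually_elim simp
      have "frequently (\<lambda>k. ?Q k \<or> ?Q (Suc k)) sequentially"
      proof (rule frequently_rev_mp[OF elim[rule_format, of K]], rule eventually_mono[OF ev], intro impI)
        fix k
        assume a: "0 < a k \<and> 0 < a (Suc k) \<and> a k \<le> a (Suc k) \<and> a (Suc k) \<le> D * b (Suc k)"
          and jump: "Suc k \<in> T \<and> (2 * real (Suc K) * D) * b (Suc k) < \<bar>X (Suc k) \<omega>\<bar>"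
        have "2 * real K * a (Suc k) \<le> 2 * real (Suc K) * (D * b (Suc k))"
          using a by (intro mult_mono) auto
        also have "\<dots> < \<bar>X (Suc k) \<omega>\<bar>" using jump by (simp add: mult_ac)
        also have "\<dots> = \<bar>?S (Suc k) - ?S k\<bar>" by simp
        finally have "2 * real K * a (Suc k) \<le> \<bar>?S (Suc k)\<bar> + \<bar>?S k\<bar>" by linarith
        then have "real K * a (Suc k) \<le> \<bar>?S (Suc k)\<bar> \<or> real K * a (Suc k) \<le> \<bar>?S k\<bar>" by linarith
        moreover have "real K * a k \<le> real K * a (Suc k)" using a by (intro mult_left_mono) auto
        ultimately have "real K * a (Suc k) \<le> \<bar>?S (Suc k)\<bar> \<or> real K * a k \<le> \<bar>?S k\<bar>" by linarith
        then show "?Q k \<or> ?Q (Suc k)" using a by (auto simp: pos_le_divide_eq)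
      qed
      then have "frequently ?Q sequentially \<or> frequently (\<lambda>k. ?Q (Suc k)) sequentially"
        by (simp only: frequently_disj_iff)
      then show "frequently ?Q sequentially"
        using eventually_sequentially_Suc[of "\<lambda>n. \<not> ?Q n"] unfolding frequently_def by blast
    qed
  qed
qed

end

section \<open>The integral test\<close>

text \<open>Compare \<open>\<phi>\<close> with the two step functions that on \<open>[k + 1, k + 2)\<close> take the value of \<open>\<phi>\<close> at the left and
  at the right end point.\<close>

lemma nn_integral_antimono_finite_iff:
  fixes \<phi> :: "real \<Rightarrow> real"
  assumes anti: "\<And>x y. 1 \<le> x \<Longrightarrow> x \<le> y \<Longrightarrow> \<phi> y \<le> \<phi> x" and nonneg: "\<And>x. 1 \<le> x \<Longrightarrow> 0 \<le> \<phi> x"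
  shows "(\<integral>\<^sup>+x\<in>{1..}. ennreal (\<phi> x) \<partial>lborel) < \<infinity> \<longleftrightarrow> summable (\<lambda>k. \<phi> (real (Suc k)))"
proof -
  define step where "step c x = (\<Sum>k. ennreal (c k) * indicator {real (Suc k)..<real (Suc (Suc k))} x)" for c :: "nat \<Rightarrow> real" and x
  have step_eq: "step c x = (if 1 \<le> x then ennreal (c (nat \<lfloor>x\<rfloor> - 1)) else 0)" for c x
  proof (cases "1 \<le> x")
    case True
    define j where "j = nat \<lfloor>x\<rfloor> - 1"
    have j: "real (Suc j) \<le> x" "x < real (Suc (Suc j))"
      using True unfolding j_def by linarith+
    have "step c x = (\<Sum>k\<in>{j}. ennreal (c k) * indicator {real (Suc k)..<real (Suc (Suc k))} x)"
      unfolding step_def using j by (intro suminf_finite) (auto simp: indicator_def)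
    then have "step c x = ennreal (c j)" using j by simp
    then show ?thesis using True unfolding j_def by simp
  next
    case False
    then have "indicator {real (Suc k)..<real (Suc (Suc k))} x = (0::ennreal)" for k by (auto simp: indicator_def)
    then show ?thesis using False by (simp add: step_def)
  qed
  have step_int: "(\<integral>\<^sup>+x. step c x \<partial>lborel) = (\<Sum>k. ennreal (c k))" for c
    unfolding step_def by (subst nn_integral_suminf) (auto simp: nn_integral_cmult_indicator)
  let ?I = "\<integral>\<^sup>+x\<in>{1..}. ennreal (\<phi> x) \<partial>lborel"
  have floor: "1 \<le> real (Suc (nat \<lfloor>x\<rfloor> - 1))" "real (Suc (nat \<lfloor>x\<rfloor> - 1)) \<le> x" "x \<le> real (Suc (Suc (nat \<lfloor>x\<rfloor> - 1)))"
    if "1 \<le> x" for x using that by linarith+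
  have "?I \<le> (\<integral>\<^sup>+x. step (\<lambda>k. \<phi> (real (Suc k))) x \<partial>lborel)"
    unfolding step_eq using floor anti by (intro nn_integral_mono) (auto simp: indicator_def intro!: ennreal_leI simp del: of_nat_Suc)
  then have upper: "?I \<le> (\<Sum>k. ennreal (\<phi> (real (Suc k))))" unfolding step_int .
  have "(\<integral>\<^sup>+x. step (\<lambda>k. \<phi> (real (Suc (Suc k)))) x \<partial>lborel) \<le> ?I"
    unfolding step_eq using floor anti by (intro nn_integral_mono) (auto simp: indicator_def intro!: ennreal_leI simp del: of_nat_Suc)
  then have lower: "(\<Sum>k. ennreal (\<phi> (real (Suc (Suc k))))) \<le> ?I" unfolding step_int .
  show ?thesis
  proof
    assume "?I < \<infinity>"
    with lower have "(\<Sum>k. ennreal (\<phi> (real (Suc (Suc k))))) \<noteq> top" by (auto simp: top_unique)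
    then have "summable (\<lambda>k. \<phi> (real (Suc (Suc k))))" using nonneg by (intro summable_suminf_not_top) auto
    then show "summable (\<lambda>k. \<phi> (real (Suc k)))" by (subst (asm) summable_Suc_iff)
  next
    assume sum: "summable (\<lambda>k. \<phi> (real (Suc k)))"
    have "(\<Sum>k. ennreal (\<phi> (real (Suc k)))) = ennreal (\<Sum>k. \<phi> (real (Suc k)))"
      by (intro suminf_ennreal_eq summable_sums sum nonneg) simp
    then show "?I < \<infinity>" using upper by (auto intro: le_less_trans)
  qed
qed

text \<open>The function \<open>f\<close> is constrained only on \<open>[1, \<infinity>)\<close>, hence the argument \<open>max 1 k\<close>; the term at
  \<open>k = 0\<close> vanishes because of division by \<open>0\<close>.\<close>

lemma integral_criterion_iff_summable:
  fixes f :: "real \<Rightarrow> real"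
  assumes "mono_on {1..} f" "\<And>x. 1 \<le> x \<Longrightarrow> 0 < f x"
  shows "(\<integral>\<^sup>+x\<in>{1..}. ennreal (1 / (x * f x)) \<partial>lborel) < \<infinity> \<longleftrightarrow> summable (\<lambda>k. 1 / (real k * f (real (max 1 k))))"
proof -
  have "(\<integral>\<^sup>+x\<in>{1..}. ennreal (1 / (x * f x)) \<partial>lborel) < \<infinity> \<longleftrightarrow> summable (\<lambda>k. 1 / (real (Suc k) * f (real (Suc k))))"
  proof (rule nn_integral_antimono_finite_iff)
    show "1 / (y * f y) \<le> 1 / (x * f x)" if "1 \<le> x" "x \<le> y" for x y
      using that assms(2)[of x] assms(2)[of y] mono_onD[OF assms(1), of x y]
      by (intro divide_left_mono mult_mono mult_pos_pos) auto
    show "0 \<le> 1 / (x * f x)" if "1 \<le> x" for x using that assms(2)[of x] by simp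
  qed
  also have "\<dots> \<longleftrightarrow> summable (\<lambda>k. 1 / (real k * f (real (max 1 k))))"
    by (subst summable_Suc_iff[symmetric]) (simp add: max_def del: of_nat_Suc)
  finally show ?thesis .
qed

section \<open>The two classes and the normalization\<close>

text \<open>The exponent of a power tail is determined by the distribution function. Hence the two classes are
  disjoint.\<close>

lemma stable_tails_distinct:
  assumes "stable_tails G1 \<alpha>1" "stable_tails G2 \<alpha>2" "\<alpha>1 < \<alpha>2"
  shows "G1 \<noteq> G2"
proof
  assume eq: "G1 = G2"
  obtain c1 \<theta>1 where 1: "0 < c1" "\<And>x. 0 < x \<Longrightarrow> 1 - G1 x = (c1 + \<theta>1 x) / x powr \<alpha>1" "(\<theta>1 \<longlongrightarrow> 0) at_top"
    using assms(1) unfolding stable_tails_def by blast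
  obtain c2 \<theta>2 where 2: "0 < c2" "\<And>x. 0 < x \<Longrightarrow> 1 - G2 x = (c2 + \<theta>2 x) / x powr \<alpha>2" "(\<theta>2 \<longlongrightarrow> 0) at_top"
    using assms(2) unfolding stable_tails_def by blast
  have "\<alpha>1 - \<alpha>2 < 0" using assms(3) by simp
  then have "((\<lambda>x::real. x powr (\<alpha>1 - \<alpha>2)) \<longlongrightarrow> 0) at_top" by real_asymp
  then have "((\<lambda>x. (c2 + \<theta>2 x) * x powr (\<alpha>1 - \<alpha>2)) \<longlongrightarrow> (c2 + 0) * 0) at_top"
    by (intro tendsto_intros 2)
  moreover have "eventually (\<lambda>x. (c2 + \<theta>2 x) * x powr (\<alpha>1 - \<alpha>2) = c1 + \<theta>1 x) at_top"
    using eventually_gt_at_top[of 0]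
  proof eventually_elim
    case (elim x)
    then show ?case using 1(2)[of x] 2(2)[of x] eq by (simp add: powr_diff field_simps)
  qed
  ultimately have "((\<lambda>x. c1 + \<theta>1 x) \<longlongrightarrow> (c2 + 0) * 0) at_top" by (rule Lim_transform_eventually)
  moreover have "((\<lambda>x. c1 + \<theta>1 x) \<longlongrightarrow> c1 + 0) at_top" by (intro tendsto_intros 1)
  ultimately show False using 1(1) tendsto_unique[OF trivial_limit_at_top_linorder] by fastforce
qed

lemma class_indices_eq: "class_indices F G n = {k. 1 \<le> k \<and> F k = G} \<inter> {1..n}"
  by (auto simp: class_indices_def)

lemma tau_eq: "tau F G = cnt {k. 1 \<le> k \<and> F k = G}"
  by (auto simp: tau_def cnt_def class_indices_eq)

lemma tendsto_zero_larger_denominator: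
  fixes u b a :: "nat \<Rightarrow> real"
  assumes "(\<lambda>n. u n / b n) \<longlonglongrightarrow> 0" "0 < c"
    and "eventually (\<lambda>n. 0 < b n) sequentially" "eventually (\<lambda>n. c * b n \<le> a n) sequentially"
  shows "(\<lambda>n. u n / a n) \<longlonglongrightarrow> 0"
proof (rule Lim_null_comparison)
  show "(\<lambda>n. \<bar>u n / b n\<bar> / c) \<longlonglongrightarrow> 0"
    using tendsto_divide[OF tendsto_rabs_zero[OF assms(1)] tendsto_const, of c] assms(2) by simp
  show "eventually (\<lambda>n. norm (u n / a n) \<le> \<bar>u n / b n\<bar> / c) sequentially"
    using assms(3,4)
  proof eventually_elim
    case (elim n)
    have "0 < c * b n" using elim assms(2) by simp
    then have "\<bar>u n\<bar> / a n \<le> \<bar>u n\<bar> / (c * b n)" using elim by (intro divide_left_mono) auto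
    then show ?case using elim \<open>0 < c * b n\<close> by (simp add: mult.commute)
  qed
qed

context prob_space
begin

text \<open>The error terms of both tails are small beyond some \<open>x0\<close>. The upper bound is extended
  to all \<open>x > 0\<close> by bounding the probability by \<open>1\<close> below \<open>x0\<close>, which is why \<open>C\<close> contains
  \<open>x0 powr \<alpha>\<close>.\<close>

lemma stable_tails_bounds:
  assumes "stable_tails G \<alpha>" "0 < \<alpha>"
  obtains C c x0 where "0 < c"
    and "\<And>X x. X \<in> borel_measurable M \<Longrightarrow> cdf (distr M borel X) = G \<Longrightarrow> 0 < x \<Longrightarrow>
      prob {\<omega>\<in>space M. x < \<bar>X \<omega>\<bar>} \<le> C * x powr - \<alpha>"
    and "\<And>X x. X \<in> borel_measurable M \<Longrightarrow> cdf (distr M borel X) = G \<Longrightarrow> x0 \<le> x \<Longrightarrow>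
      c * x powr - \<alpha> \<le> prob {\<omega>\<in>space M. x < \<bar>X \<omega>\<bar>}"
proof -
  obtain c1 c2 \<theta> \<beta> where c: "0 < c1" "0 < c2"
    and G: "\<And>x. 0 < x \<Longrightarrow> 1 - G x = (c1 + \<theta> x) / x powr \<alpha>" "\<And>x. 0 < x \<Longrightarrow> G (- x) = (c2 + \<beta> (- x)) / x powr \<alpha>"
    and lim: "(\<theta> \<longlongrightarrow> 0) at_top" "((\<lambda>x. \<beta> (- x)) \<longlongrightarrow> 0) at_top"
    using assms(1) unfolding stable_tails_def by blast
  have "eventually (\<lambda>x. \<bar>\<theta> x\<bar> < c1 / 2) at_top" "eventually (\<lambda>x. \<bar>\<beta> (- x)\<bar> < c2) at_top"
    using c tendstoD[OF lim(1), of "c1 / 2"] tendstoD[OF lim(2), of c2] by (auto simp: dist_real_def)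
  then have "eventually (\<lambda>x. \<bar>\<theta> x\<bar> < c1 / 2 \<and> \<bar>\<beta> (- x)\<bar> < c2 \<and> 0 < x) at_top"
    using eventually_gt_at_top[of 0] by eventually_elim auto
  then obtain x0 where x0: "\<And>x. x0 \<le> x \<Longrightarrow> \<bar>\<theta> x\<bar> < c1 / 2 \<and> \<bar>\<beta> (- x)\<bar> < c2 \<and> 0 < x"
    by (auto simp: eventually_at_top_linorder)
  have x0pos: "0 < x0" using x0[of x0] by simp
  have right: "prob {\<omega>\<in>space M. x < X \<omega>} = 1 - G x" and left: "prob {\<omega>\<in>space M. X \<omega> \<le> x} = G x"
    if [measurable]: "X \<in> borel_measurable M" and cdf: "cdf (distr M borel X) = G" for X x
  proof -
    have "G x = prob (X -` {..x} \<inter> space M)" unfolding cdf[symmetric] cdf_def by (rule measure_distr) auto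
    also have "X -` {..x} \<inter> space M = {\<omega>\<in>space M. X \<omega> \<le> x}" by auto
    finally show *: "prob {\<omega>\<in>space M. X \<omega> \<le> x} = G x" by simp
    have "prob {\<omega>\<in>space M. x < X \<omega>} = prob (space M - {\<omega>\<in>space M. X \<omega> \<le> x})"
      by (intro arg_cong[where f=prob]) auto
    also have "\<dots> = 1 - G x" by (subst prob_compl) (auto simp: *)
    finally show "prob {\<omega>\<in>space M. x < X \<omega>} = 1 - G x" .
  qed
  show ?thesis
  proof (rule that[of "c1 / 2" "2 * c1 + 2 * c2 + x0 powr \<alpha>" x0])
    show "0 < c1 / 2" using c by simp
  next
    fix X and x :: real
    assume [measurable]: "X \<in> borel_measurable M" and cdf: "cdf (distr M borel X) = G" and x: "0 < x"
    show "prob {\<omega>\<in>space M. x < \<bar>X \<omega>\<bar>} \<le> (2 * c1 + 2 * c2 + x0 powr \<alpha>) * x powr - \<alpha>"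
    proof (cases "x0 \<le> x")
      case True
      have "prob {\<omega>\<in>space M. x < \<bar>X \<omega>\<bar>} \<le> prob ({\<omega>\<in>space M. x < X \<omega>} \<union> {\<omega>\<in>space M. X \<omega> \<le> - x})"
        by (intro finite_measure_mono) auto
      also have "\<dots> \<le> prob {\<omega>\<in>space M. x < X \<omega>} + prob {\<omega>\<in>space M. X \<omega> \<le> - x}"
        by (rule measure_Un_le) auto
      also have "\<dots> = (c1 + \<theta> x + (c2 + \<beta> (- x))) * x powr - \<alpha>"
        by (simp add: right[OF _ cdf] left[OF _ cdf] G[OF x] powr_minus divide_inverse distrib_right)
      also have "\<dots> \<le> (2 * c1 + 2 * c2 + x0 powr \<alpha>) * x powr - \<alpha>"
      proof (rule mult_right_mono)
        show "c1 + \<theta> x + (c2 + \<beta> (- x)) \<le> 2 * c1 + 2 * c2 + x0 powr \<alpha>"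
          using x0[OF True] c powr_ge_zero[of x0 \<alpha>] by linarith
      qed simp
      finally show ?thesis .
    next
      case False
      have "prob {\<omega>\<in>space M. x < \<bar>X \<omega>\<bar>} \<le> 1" by simp
      also have "1 \<le> x0 powr \<alpha> * x powr - \<alpha>"
        using False x assms(2) powr_mono2[of \<alpha> x x0] by (simp add: powr_minus field_simps)
      also have "\<dots> \<le> (2 * c1 + 2 * c2 + x0 powr \<alpha>) * x powr - \<alpha>"
        using c by (intro mult_right_mono) auto
      finally show ?thesis .
    qed
  next
    fix X and x :: real
    assume [measurable]: "X \<in> borel_measurable M" and cdf: "cdf (distr M borel X) = G" and x: "x0 \<le> x"
    have xpos: "0 < x" using x x0pos by simp
    have "c1 / 2 * x powr - \<alpha> \<le> (c1 + \<theta> x) * x powr - \<alpha>"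
      using x0[OF x] by (intro mult_right_mono) auto
    also have "\<dots> = prob {\<omega>\<in>space M. x < X \<omega>}"
      by (simp add: right[OF _ cdf] G(1)[OF xpos] powr_minus divide_inverse)
    also have "\<dots> \<le> prob {\<omega>\<in>space M. x < \<bar>X \<omega>\<bar>}" by (intro finite_measure_mono) auto
    finally show "c1 / 2 * x powr - \<alpha> \<le> prob {\<omega>\<in>space M. x < \<bar>X \<omega>\<bar>}" .
  qed
qed

lemma expectation_eq_if_cdf_eq:
  assumes [measurable]: "X \<in> borel_measurable M" "Y \<in> borel_measurable M"
    and "cdf (distr M borel X) = cdf (distr M borel Y)"
  shows "expectation X = expectation Y"
proof -
  have "distr M borel X = distr M borel Y" by (intro cdf_unique real_distribution_distr assms)
  moreover have "expectation X = integral\<^sup>L (distr M borel X) (\<lambda>x. x)" by (simp add: integral_distr)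
  moreover have "expectation Y = integral\<^sup>L (distr M borel Y) (\<lambda>x. x)" by (simp add: integral_distr)
  ultimately show ?thesis by simp
qed

text \<open>For \<open>\<alpha> > 1\<close> the centering is \<open>0\<close>, so the convergence in law forces the common mean of the
  class to vanish.\<close>

lemma class_sum_asymptotically_negligible:
  fixes X :: "nat \<Rightarrow> 'a \<Rightarrow> real" and g :: "nat \<Rightarrow> real"
  assumes indep: "indep_vars (\<lambda>_. borel) X {1..}"
    and cdf: "\<And>n. 1 \<le> n \<Longrightarrow> cdf (distr M borel (X n)) = F n"
    and \<alpha>: "0 < \<alpha>" "\<alpha> < 2" and tails: "stable_tails G \<alpha>"
    and inf: "filterlim (tau F G) at_top sequentially"
    and centering: "centering_convention \<alpha> d"
    and conv: "converges_to_stable \<alpha> lam (\<lambda>n. distr M borel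
           (\<lambda>\<omega>. (class_sum F G X n \<omega> - d (tau F G n)) / real (tau F G n) powr (1 / \<alpha>)))"
    and g: "mono g" "\<And>n. 0 < g n"
    and sum: "summable (\<lambda>k. if 1 \<le> k \<and> F k = G then 1 / (real (tau F G k) * g k) else 0)"
  shows "AE \<omega> in M. (\<lambda>n. class_sum F G X n \<omega> / (real (tau F G n) * g n) powr (1 / \<alpha>)) \<longlonglongrightarrow> 0"
proof -
  let ?T = "{k. 1 \<le> k \<and> F k = G}"
  have T: "?T \<subseteq> {1..}" by auto
  have Xm: "X k \<in> borel_measurable M" if "1 \<le> k" for k using indep that by (auto simp: indep_vars_def)
  obtain C where tail: "\<And>X x. X \<in> borel_measurable M \<Longrightarrow> cdf (distr M borel X) = G \<Longrightarrow> 0 < x \<Longrightarrow>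
      prob {\<omega>\<in>space M. x < \<bar>X \<omega>\<bar>} \<le> C * x powr - \<alpha>"
    using stable_tails_bounds[OF tails \<alpha>(1)] by metis
  have tailX: "prob {\<omega>\<in>space M. x < \<bar>X k \<omega>\<bar>} \<le> C * x powr - \<alpha>" if "k \<in> ?T" "0 < x" for k x
    using that by (intro tail Xm) (auto simp: cdf)
  have inf': "filterlim (cnt ?T) at_top sequentially" using inf by (simp add: tau_eq)
  have mean: "expectation (X k) = 0" if \<alpha>1: "1 < \<alpha>" and k: "k \<in> ?T" for k
  proof -
    obtain L where L: "real_distribution L" "weak_conv_m (\<lambda>n. distr M borel
           (\<lambda>\<omega>. (class_sum F G X n \<omega> - d (tau F G n)) / real (tau F G n) powr (1 / \<alpha>))) L"
      using conv unfolding converges_to_stable_def stable_law_def by blast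
    have d: "d m = 0" for m using centering \<alpha>1 unfolding centering_convention_def by simp
    show ?thesis
    proof (rule mean_zero_if_weakly_convergent[OF indep T inf' \<alpha>1 \<alpha>(2) tailX _ L(1)])
      show "expectation (X j) = expectation (X k)" if "j \<in> ?T" for j
        using that k by (intro expectation_eq_if_cdf_eq Xm) (auto simp: cdf)
      show "weak_conv_m (\<lambda>n. distr M borel (\<lambda>\<omega>. (\<Sum>k\<in>?T \<inter> {1..n}. X k \<omega>) / real (cnt ?T n) powr (1 / \<alpha>))) L"
        using L(2) by (simp only: d class_sum_def class_indices_eq tau_eq diff_zero)
    qed
  qed
  have "summable (\<lambda>k. if k \<in> ?T then 1 / (real (cnt ?T k) * g k) else 0)"
    using sum by (simp only: tau_eq mem_Collect_eq)
  from class_sum_negligible[OF indep T inf' \<alpha> tailX mean g this]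
  show ?thesis by (simp only: class_sum_def class_indices_eq tau_eq)
qed

text \<open>The integral is deterministic, so two one-sided implications give both equivalences.\<close>

lemma zero_infinity_dichotomy:
  fixes L :: "'a \<Rightarrow> ereal" and I :: ennreal
  assumes "I < \<infinity> \<Longrightarrow> AE \<omega> in M. L \<omega> = 0" "\<not> I < \<infinity> \<Longrightarrow> AE \<omega> in M. L \<omega> = \<infinity>"
  shows "AE \<omega> in M. (L \<omega> = 0 \<longleftrightarrow> I < \<infinity>) \<and> (L \<omega> = \<infinity> \<longleftrightarrow> I = \<infinity>)"
proof (cases "I < \<infinity>")
  case True
  show ?thesis using assms(1)[OF True] by eventually_elim (use True in auto)
next
  case False
  then have "I = \<infinity>" by (simp add: less_top[symmetric])
  show ?thesis using assms(2)[OF False] by eventually_elim (use \<open>I = \<infinity>\<close> in auto)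
qed

end

lemma powr_comparison:
  fixes x y c p q :: real
  assumes "0 < p" "0 < q" "0 < c" "0 \<le> x" "0 \<le> y" "c * y powr p \<le> x powr q"
  shows "c powr (1 / (p * q)) * y powr (1 / q) \<le> x powr (1 / p)"
proof -
  have "c powr (1 / (p * q)) * y powr (1 / q) = (c * y powr p) powr (1 / (p * q))"
    using assms by (simp add: powr_mult powr_powr)
  also have "\<dots> \<le> (x powr q) powr (1 / (p * q))"
    using assms by (intro powr_mono2) auto
  also have "\<dots> = x powr (1 / p)" using assms by (simp add: powr_powr)
  finally show ?thesis .
qed

text \<open>For \<open>\<Lambda> > 0\<close> the normalization dominates the natural scales of both classes and has the order of that
  of the first class: a positive lower bound on the ratio of the counts bounds the scale of the
  second class by that of the first, and if \<open>\<Lambda>\<close> is finite an upper bound gives the converse.\<close>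

lemma normalizer_asymptotics:
  fixes T1 T2 :: "nat \<Rightarrow> nat" and \<Lambda> :: ennreal
  assumes \<alpha>: "0 < \<alpha>1" "0 < \<alpha>2"
    and inf: "filterlim T1 at_top sequentially" "filterlim T2 at_top sequentially"
    and lim: "(\<lambda>n. ennreal (real (T1 n) powr \<alpha>2 / real (T2 n) powr \<alpha>1)) \<longlonglongrightarrow> \<Lambda>" and pos: "0 < \<Lambda>"
  obtains c \<kappa> K where "0 < c" "0 < \<kappa>" "0 < K"
    and "eventually (\<lambda>n. c * real (T2 n) powr \<alpha>1 \<le> real (T1 n) powr \<alpha>2) sequentially"
    and "eventually (\<lambda>n. \<kappa> * real (T1 n) powr (1 / \<alpha>1) \<le> normalizer \<alpha>1 \<alpha>2 \<Lambda> T1 T2 n) sequentially"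
    and "eventually (\<lambda>n. \<kappa> * real (T2 n) powr (1 / \<alpha>2) \<le> normalizer \<alpha>1 \<alpha>2 \<Lambda> T1 T2 n) sequentially"
    and "eventually (\<lambda>n. normalizer \<alpha>1 \<alpha>2 \<Lambda> T1 T2 n \<le> K * real (T1 n) powr (1 / \<alpha>1)) sequentially"
proof -
  let ?r = "\<lambda>n. real (T1 n) powr \<alpha>2 / real (T2 n) powr \<alpha>1"
  let ?B = "normalizer \<alpha>1 \<alpha>2 \<Lambda> T1 T2"
  obtain y where "0 < y" "y < \<Lambda>" using dense[OF pos] by blast
  then obtain c where c: "0 < c" "ennreal c < \<Lambda>" by (cases y) auto
  have T2: "eventually (\<lambda>n. 1 \<le> T2 n) sequentially" using inf(2) unfolding filterlim_at_top by blast
  have lower: "eventually (\<lambda>n. c * real (T2 n) powr \<alpha>1 \<le> real (T1 n) powr \<alpha>2) sequentially"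
    using order_tendstoD(1)[OF lim c(2)] T2
  proof eventually_elim
    case (elim n)
    then have "c \<le> ?r n" using c by (simp add: ennreal_less_iff less_imp_le)
    then show ?case using elim by (simp add: field_simps)
  qed
  define k where "k = c powr (1 / (\<alpha>1 * \<alpha>2))"
  have k: "0 < k" using c by (simp add: k_def)
  have lower': "eventually (\<lambda>n. k * real (T2 n) powr (1 / \<alpha>2) \<le> real (T1 n) powr (1 / \<alpha>1)) sequentially"
    using lower unfolding k_def
    by eventually_elim (rule powr_comparison, use \<alpha> c in auto)
  show ?thesis
  proof (cases "\<Lambda> = \<infinity>")
    case True
    then have B: "?B n = real (T1 n) powr (1 / \<alpha>1)" for n by (simp add: normalizer_def)
    show ?thesis
    proof (rule that[of c "min 1 k" 1])
      show "eventually (\<lambda>n. min 1 k * real (T1 n) powr (1 / \<alpha>1) \<le> ?B n) sequentially"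
        unfolding B using k by (intro always_eventually allI mult_left_le_one_le) auto
      show "eventually (\<lambda>n. min 1 k * real (T2 n) powr (1 / \<alpha>2) \<le> ?B n) sequentially"
        using lower' unfolding B
        by eventually_elim (rule order_trans[OF mult_right_mono], auto)
    qed (use c k lower B in auto)
  next
    case False
    then have B: "?B n = real (T2 n) powr (1 / \<alpha>2)" for n by (simp add: normalizer_def)
    have "\<Lambda> < top" using False by (simp add: less_top)
    then obtain z where "\<Lambda> < z" "z < top" using dense by blast
    then obtain D where D: "\<Lambda> < ennreal D" by (cases z) auto
    have D0: "0 < D" using order.strict_trans[OF pos D] by (simp add: ennreal_less_zero_iff)
    note D = D0 D
    have T1: "eventually (\<lambda>n. 1 \<le> T1 n) sequentially" using inf(1) unfolding filterlim_at_top by blast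
    have upper: "eventually (\<lambda>n. 1 / D * real (T1 n) powr \<alpha>2 \<le> real (T2 n) powr \<alpha>1) sequentially"
      using order_tendstoD(2)[OF lim D(2)] T2
    proof eventually_elim
      case (elim n)
      then have "?r n \<le> D" using D by (simp add: ennreal_less_iff less_imp_le)
      then show ?case using elim D by (simp add: field_simps)
    qed
    define j where "j = (1 / D) powr (1 / (\<alpha>2 * \<alpha>1))"
    have j: "0 < j" using D by (simp add: j_def)
    have upper': "eventually (\<lambda>n. j * real (T1 n) powr (1 / \<alpha>1) \<le> real (T2 n) powr (1 / \<alpha>2)) sequentially"
      using upper unfolding j_def
      by eventually_elim (rule powr_comparison, use \<alpha> D in auto)
    show ?thesis
    proof (rule that[of c "min 1 j" "1 / k"])
      show "eventually (\<lambda>n. min 1 j * real (T1 n) powr (1 / \<alpha>1) \<le> ?B n) sequentially"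
        using upper' unfolding B
        by eventually_elim (rule order_trans[OF mult_right_mono], auto)
      show "eventually (\<lambda>n. min 1 j * real (T2 n) powr (1 / \<alpha>2) \<le> ?B n) sequentially"
        unfolding B using j by (intro always_eventually allI mult_left_le_one_le) auto
      show "eventually (\<lambda>n. ?B n \<le> 1 / k * real (T1 n) powr (1 / \<alpha>1)) sequentially"
        using lower' unfolding B by eventually_elim (use k in \<open>simp add: field_simps\<close>)
    qed (use c k j lower in auto)
  qed
qed

text \<open>The members of the two classes add up to \<open>n\<close>. Either the first class contains half of them, or the
  second one does and then the ratio of the counts bounds the first from below.\<close>

lemma count_power_lower_bound:
  fixes t1 t2 p q c n :: real
  assumes p: "0 < p" "p < q" and c: "0 < c" and n: "2 \<le> n" and t: "0 \<le> t1" "0 \<le> t2" "n \<le> t1 + t2"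
    and le: "c * t2 powr p \<le> t1 powr q"
  shows "min 1 (c powr (1 / q)) * (1 / 2) powr (p / q) * n powr (p / q) \<le> t1"
proof -
  have pq: "0 < p / q" "p / q < 1" using p by auto
  have half: "(n / 2) powr (p / q) = (1 / 2) powr (p / q) * n powr (p / q)"
    using n powr_mult[of "1 / 2" n "p / q"] by simp
  have "min 1 (c powr (1 / q)) * (n / 2) powr (p / q) \<le> t1"
  proof (cases "n / 2 \<le> t1")
    case True
    have "(n / 2) powr (p / q) \<le> (n / 2) powr 1" using n pq by (intro powr_mono) auto
    then have "(n / 2) powr (p / q) \<le> t1" using True n by simp
    then show ?thesis by (intro order_trans[OF mult_left_le_one_le]) auto
  next
    case False
    then have "n / 2 \<le> t2" using t by linarith
    then have "c * (n / 2) powr p \<le> c * t2 powr p" using n p c by (intro mult_left_mono powr_mono2) auto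
    also note le
    finally have "(c * (n / 2) powr p) powr (1 / q) \<le> (t1 powr q) powr (1 / q)"
      using c p by (intro powr_mono2) auto
    then have "c powr (1 / q) * (n / 2) powr (p / q) \<le> t1"
      using c p t(1) by (simp add: powr_mult powr_powr)
    moreover have "min 1 (c powr (1 / q)) * (n / 2) powr (p / q) \<le> c powr (1 / q) * (n / 2) powr (p / q)"
      by (intro mult_right_mono) auto
    ultimately show ?thesis by linarith
  qed
  then show ?thesis by (simp add: half mult.assoc)
qed

section \<open>The dichotomy\<close>

theorem theorem3p3:
  fixes M :: "'a measure"
    and X :: "nat \<Rightarrow> 'a \<Rightarrow> real"
    and F :: "nat \<Rightarrow> real \<Rightarrow> real"
    and G1 G2 f :: "real \<Rightarrow> real"
    and \<alpha>1 \<alpha>2 lam1 lam2 :: real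
    and d1 d2 :: "nat \<Rightarrow> real"
    and \<tau>1 \<tau>2 :: "nat \<Rightarrow> nat"
    and S :: "nat \<Rightarrow> 'a \<Rightarrow> real"
    and B :: "nat \<Rightarrow> real"
    and \<Lambda> :: ennreal
  defines "\<tau>1 \<equiv> tau F G1"
    and "\<tau>2 \<equiv> tau F G2"
    and "S \<equiv> partial_sum X"
    and "B \<equiv> normalizer \<alpha>1 \<alpha>2 \<Lambda> \<tau>1 \<tau>2"
  assumes "0 < \<alpha>1" "\<alpha>1 < \<alpha>2" "\<alpha>2 < 2" "0 < lam1" "0 < lam2"
    and "prob_space M"
    and "prob_space.indep_vars M (\<lambda>_. borel) X {1..}"
    and "\<And>n. n \<ge> 1 \<Longrightarrow> F n \<in> {G1, G2}"
    and "\<And>n. n \<ge> 1 \<Longrightarrow> cdf (distr M borel (X n)) = F n"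
    and "domain_normal_attraction G1 \<alpha>1 lam1" "domain_normal_attraction G2 \<alpha>2 lam2"
    and "stable_tails G1 \<alpha>1" "stable_tails G2 \<alpha>2"
    and "filterlim \<tau>1 at_top sequentially" "filterlim \<tau>2 at_top sequentially"
    and "centering_convention \<alpha>1 d1" "centering_convention \<alpha>2 d2"
    and "converges_to_stable \<alpha>1 lam1 (\<lambda>n. distr M borel
           (\<lambda>\<omega>. (class_sum F G1 X n \<omega> - d1 (\<tau>1 n)) / real (\<tau>1 n) powr (1 / \<alpha>1)))"
    and "converges_to_stable \<alpha>2 lam2 (\<lambda>n. distr M borel
           (\<lambda>\<omega>. (class_sum F G2 X n \<omega> - d2 (\<tau>2 n)) / real (\<tau>2 n) powr (1 / \<alpha>2)))"
    and "has_proper_limit M X"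
    and "(\<lambda>n. ennreal (real (\<tau>1 n) powr \<alpha>2 / real (\<tau>2 n) powr \<alpha>1)) \<longlonglongrightarrow> \<Lambda>"
    and "mono_on {1..} f" "\<And>x. x \<ge> 1 \<Longrightarrow> 0 < f x"
  shows "(0 < \<Lambda> \<longrightarrow>
      (AE \<omega> in M.
        (limsup (\<lambda>n. ereal (\<bar>S n \<omega>\<bar> / (B n * f (real n) powr (1 / \<alpha>1)))) = 0 \<longleftrightarrow>
           (\<integral>\<^sup>+x\<in>{1..}. ennreal (1 / (x * f x)) \<partial>lborel) < \<infinity>) \<and>
        (limsup (\<lambda>n. ereal (\<bar>S n \<omega>\<bar> / (B n * f (real n) powr (1 / \<alpha>1)))) = \<infinity> \<longleftrightarrow>
           (\<integral>\<^sup>+x\<in>{1..}. ennreal (1 / (x * f x)) \<partial>lborel) = \<infinity>))) \<and>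
    (\<Lambda> = 0 \<and>
      (\<exists>\<mu> > (\<alpha>2 - \<alpha>1) / \<alpha>2. \<forall>\<^sub>F n in sequentially.
         real (\<tau>1 n) < real n powr (\<alpha>1 / \<alpha>2) * ln (real n) powr (- \<mu>)) \<longrightarrow>
      (AE \<omega> in M.
        (limsup (\<lambda>n. ereal (\<bar>S n \<omega>\<bar> / (B n * f (real n) powr (1 / \<alpha>2)))) = 0 \<longleftrightarrow>
           (\<integral>\<^sup>+x\<in>{1..}. ennreal (1 / (x * f x)) \<partial>lborel) < \<infinity>) \<and>
        (limsup (\<lambda>n. ereal (\<bar>S n \<omega>\<bar> / (B n * f (real n) powr (1 / \<alpha>2)))) = \<infinity> \<longleftrightarrow>
           (\<integral>\<^sup>+x\<in>{1..}. ennreal (1 / (x * f x)) \<partial>lborel) = \<infinity>)))"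
proof -
  interpret prob_space M by fact
  have a1: "0 < \<alpha>1" "\<alpha>1 < 2" and a2: "0 < \<alpha>2" "\<alpha>2 < 2" and a12: "\<alpha>1 < \<alpha>2"
    using assms(5-7) by auto
  have indep: "indep_vars (\<lambda>_. borel) X {1..}" by fact
  have cdf: "\<And>n. 1 \<le> n \<Longrightarrow> cdf (distr M borel (X n)) = F n" by fact
  have tails: "stable_tails G1 \<alpha>1" "stable_tails G2 \<alpha>2" by fact+
  have inf: "filterlim (tau F G1) at_top sequentially" "filterlim (tau F G2) at_top sequentially"
    using \<open>filterlim \<tau>1 at_top sequentially\<close> \<open>filterlim \<tau>2 at_top sequentially\<close> unfolding \<tau>1_def \<tau>2_def .
  have conv1: "converges_to_stable \<alpha>1 lam1 (\<lambda>n. distr M borel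
           (\<lambda>\<omega>. (class_sum F G1 X n \<omega> - d1 (tau F G1 n)) / real (tau F G1 n) powr (1 / \<alpha>1)))"
    and conv2: "converges_to_stable \<alpha>2 lam2 (\<lambda>n. distr M borel
           (\<lambda>\<omega>. (class_sum F G2 X n \<omega> - d2 (tau F G2 n)) / real (tau F G2 n) powr (1 / \<alpha>2)))"
    using assms(22,23) unfolding \<tau>1_def \<tau>2_def .
  let ?T1 = "{k. 1 \<le> k \<and> F k = G1}" and ?T2 = "{k. 1 \<le> k \<and> F k = G2}"
  have t1: "\<tau>1 = cnt ?T1" and t2: "\<tau>2 = cnt ?T2" by (simp_all only: \<tau>1_def \<tau>2_def tau_eq)
  have T: "?T1 \<subseteq> {1..}" "?T2 \<subseteq> {1..}" by auto
  have disj: "G1 \<noteq> G2" by (rule stable_tails_distinct[OF tails a12])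
  have cover: "{1..n} = (?T1 \<inter> {1..n}) \<union> (?T2 \<inter> {1..n})" for n
  proof (intro equalityI subsetI)
    fix k assume "k \<in> {1..n}"
    then show "k \<in> (?T1 \<inter> {1..n}) \<union> (?T2 \<inter> {1..n})"
      using \<open>\<And>n. n \<ge> 1 \<Longrightarrow> F n \<in> {G1, G2}\<close>[of k] by auto
  qed auto
  have disjoint: "(?T1 \<inter> {1..n}) \<inter> (?T2 \<inter> {1..n}) = {}" for n using disj by auto
  have total: "real (\<tau>1 n) + real (\<tau>2 n) = real n" for n
  proof -
    have "card {1..n} = card (?T1 \<inter> {1..n}) + card (?T2 \<inter> {1..n})"
      by (subst cover) (intro card_Un_disjoint disjoint; simp)
    then show ?thesis by (simp add: t1 t2 cnt_def)
  qed
  have split: "S n \<omega> = class_sum F G1 X n \<omega> + class_sum F G2 X n \<omega>" for n \<omega>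
  proof -
    have "(\<Sum>k=1..n. X k \<omega>) = (\<Sum>k\<in>?T1 \<inter> {1..n}. X k \<omega>) + (\<Sum>k\<in>?T2 \<inter> {1..n}. X k \<omega>)"
      by (subst cover) (intro sum.union_disjoint disjoint; simp)
    then show ?thesis by (simp only: S_def partial_sum_def class_sum_def class_indices_eq)
  qed
  have inf1: "filterlim \<tau>1 at_top sequentially" and inf2: "filterlim \<tau>2 at_top sequentially" by fact+
  have mono_t: "mono \<tau>1" "mono \<tau>2" unfolding t1 t2 by (rule mono_cnt)+
  have pos1: "eventually (\<lambda>n. 1 \<le> \<tau>1 n) sequentially" using inf1 unfolding filterlim_at_top by blast
  have pos2: "eventually (\<lambda>n. 1 \<le> \<tau>2 n) sequentially" using inf2 unfolding filterlim_at_top by blast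

  \<comment> \<open>Nothing is known of \<open>f\<close> at \<open>0\<close>; replacing that single value makes the sequence monotone and positive.\<close>
  define g where "g n = f (real (max 1 n))" for n
  have g: "mono g" "\<And>n. 0 < g n"
  proof -
    show "mono g"
      unfolding g_def using \<open>mono_on {1..} f\<close> by (intro monoI) (auto elim!: mono_onD)
    show "0 < g n" for n
      unfolding g_def using \<open>\<And>x. x \<ge> 1 \<Longrightarrow> 0 < f x\<close> by simp
  qed
  have g_f: "eventually (\<lambda>n. f (real n) = g n) sequentially"
    using eventually_ge_at_top[of 1] by eventually_elim (simp add: g_def)
  let ?I = "\<integral>\<^sup>+x\<in>{1..}. ennreal (1 / (x * f x)) \<partial>lborel"
  have I: "?I < \<infinity> \<longleftrightarrow> summable (\<lambda>k. 1 / (real k * g k))"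
    unfolding g_def by (rule integral_criterion_iff_summable) fact+

  have neg1: "AE \<omega> in M. (\<lambda>n. class_sum F G1 X n \<omega> / (real (\<tau>1 n) * h n) powr (1 / \<alpha>1)) \<longlonglongrightarrow> 0"
    if "mono h" "\<And>n. 0 < h n" "summable (\<lambda>k. 1 / (real k * h k))" for h :: "nat \<Rightarrow> real"
  proof -
    have "summable (\<lambda>k. if k \<in> ?T1 then 1 / (real (cnt ?T1 k) * h k) else 0)"
      by (rule summable_class_weights[OF T(1) that])
    then have "summable (\<lambda>k. if 1 \<le> k \<and> F k = G1 then 1 / (real (tau F G1 k) * h k) else 0)"
      by (simp only: tau_eq mem_Collect_eq)
    from class_sum_asymptotically_negligible[OF indep cdf a1 tails(1) inf(1) \<open>centering_convention \<alpha>1 d1\<close> conv1 that(1,2) this]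
    show ?thesis unfolding \<tau>1_def .
  qed
  have neg2: "AE \<omega> in M. (\<lambda>n. class_sum F G2 X n \<omega> / (real (\<tau>2 n) * h n) powr (1 / \<alpha>2)) \<longlonglongrightarrow> 0"
    if "mono h" "\<And>n. 0 < h n" "summable (\<lambda>k. 1 / (real k * h k))" for h :: "nat \<Rightarrow> real"
  proof -
    have "summable (\<lambda>k. if k \<in> ?T2 then 1 / (real (cnt ?T2 k) * h k) else 0)"
      by (rule summable_class_weights[OF T(2) that])
    then have "summable (\<lambda>k. if 1 \<le> k \<and> F k = G2 then 1 / (real (tau F G2 k) * h k) else 0)"
      by (simp only: tau_eq mem_Collect_eq)
    from class_sum_asymptotically_negligible[OF indep cdf a2 tails(2) inf(2) \<open>centering_convention \<alpha>2 d2\<close> conv2 that(1,2) this]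
    show ?thesis unfolding \<tau>2_def .
  qed
  \<comment> \<open>The first class may be measured against another sequence \<open>h\<close>, as the second part requires.\<close>
  have conv_case: "AE \<omega> in M. limsup (\<lambda>n. ereal (\<bar>S n \<omega>\<bar> / a n)) = 0"
    if h: "mono h" "\<And>n. 0 < h n" "summable (\<lambda>k. 1 / (real k * h k))" and sum: "summable (\<lambda>k. 1 / (real k * g k))"
      and \<kappa>: "0 < \<kappa>"
      and le1: "eventually (\<lambda>n. \<kappa> * (real (\<tau>1 n) * h n) powr (1 / \<alpha>1) \<le> a n) sequentially"
      and le2: "eventually (\<lambda>n. \<kappa> * (real (\<tau>2 n) * g n) powr (1 / \<alpha>2) \<le> a n) sequentially"
    for h a :: "nat \<Rightarrow> real" and \<kappa> :: real
    using neg1[OF h] neg2[OF g sum]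
  proof eventually_elim
    case (elim \<omega>)
    have 1: "(\<lambda>n. class_sum F G1 X n \<omega> / a n) \<longlonglongrightarrow> 0"
    proof (rule tendsto_zero_larger_denominator[OF elim(1) \<kappa> _ le1])
      show "eventually (\<lambda>n. 0 < (real (\<tau>1 n) * h n) powr (1 / \<alpha>1)) sequentially"
        using pos1 by eventually_elim (use h(2) in \<open>simp add: less_imp_neq[symmetric]\<close>)
    qed
    have 2: "(\<lambda>n. class_sum F G2 X n \<omega> / a n) \<longlonglongrightarrow> 0"
    proof (rule tendsto_zero_larger_denominator[OF elim(2) \<kappa> _ le2])
      show "eventually (\<lambda>n. 0 < (real (\<tau>2 n) * g n) powr (1 / \<alpha>2)) sequentially"
        using pos2 by eventually_elim (use g(2) in \<open>simp add: less_imp_neq[symmetric]\<close>)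
    qed
    have "(\<lambda>n. \<bar>S n \<omega> / a n\<bar>) \<longlonglongrightarrow> 0"
      using tendsto_rabs_zero[OF tendsto_add_zero[OF 1 2]] by (simp add: split add_divide_distrib)
    moreover have "eventually (\<lambda>n. \<bar>S n \<omega> / a n\<bar> = \<bar>S n \<omega>\<bar> / a n) sequentially"
      using le1
    proof eventually_elim
      case (elim n)
      have "0 \<le> \<kappa> * (real (\<tau>1 n) * h n) powr (1 / \<alpha>1)" using \<kappa> by simp
      then have "0 \<le> a n" using elim by linarith
      then show ?case by simp
    qed
    ultimately have "(\<lambda>n. \<bar>S n \<omega>\<bar> / a n) \<longlonglongrightarrow> 0" by (rule Lim_transform_eventually)
    then have "(\<lambda>n. ereal (\<bar>S n \<omega>\<bar> / a n)) \<longlonglongrightarrow> ereal 0" by simp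
    from lim_imp_Limsup[OF trivial_limit_sequentially this] show ?case by (simp add: zero_ereal_def)
  qed
  have div_case: "AE \<omega> in M. limsup (\<lambda>n. ereal (\<bar>S n \<omega>\<bar> / a n)) = \<infinity>"
    if G: "stable_tails G \<alpha>" "0 < \<alpha>" and Tinf: "filterlim (cnt {k. 1 \<le> k \<and> F k = G}) at_top sequentially"
      and p: "0 < p" "0 < c" "eventually (\<lambda>n. c * real n powr p \<le> real (cnt {k. 1 \<le> k \<and> F k = G} n)) sequentially"
      and div: "\<not> summable (\<lambda>k. 1 / (real k * g k))"
      and a: "eventually (\<lambda>n. 0 < a n) sequentially" "eventually (\<lambda>n. a n \<le> a (Suc n)) sequentially"
      and D: "0 < D" "eventually (\<lambda>n. a n \<le> D * (real (cnt {k. 1 \<le> k \<and> F k = G} n) * g n) powr (1 / \<alpha>)) sequentially"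
    for G :: "real \<Rightarrow> real" and \<alpha> p c D :: real and a :: "nat \<Rightarrow> real"
  proof -
    let ?T = "{k. 1 \<le> k \<and> F k = G}"
    have Xm: "X k \<in> borel_measurable M" if "1 \<le> k" for k using indep that by (auto simp: indep_vars_def)
    obtain c0 x0 where c0: "0 < c0" and tail: "\<And>X x. X \<in> borel_measurable M \<Longrightarrow> cdf (distr M borel X) = G \<Longrightarrow> x0 \<le> x \<Longrightarrow>
      c0 * x powr - \<alpha> \<le> prob {\<omega>\<in>space M. x < \<bar>X \<omega>\<bar>}"
      using stable_tails_bounds[OF G] by metis
    obtain C where C: "\<And>n. p * harm n \<le> harm (cnt ?T n) + C" using harm_cnt_growth[OF p] by blast
    have sub: "?T \<subseteq> {1..}" by auto
    have "AE \<omega> in M. limsup (\<lambda>n. ereal (\<bar>\<Sum>k=1..n. X k \<omega>\<bar> / a n)) = \<infinity>"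
    proof (rule limsup_partial_sums_infinite[OF indep sub Tinf G(2) c0 _ g _ a D])
      show "c0 * x powr - \<alpha> \<le> prob {\<omega>\<in>space M. x < \<bar>X k \<omega>\<bar>}" if "k \<in> ?T" "x0 \<le> x" for k x
        using that by (intro tail Xm) (auto simp: cdf)
      show "\<not> summable (\<lambda>k. if k \<in> ?T then 1 / (real (cnt ?T k) * g k) else 0)"
        by (rule not_summable_over_cnt[OF sub g p(1) C div])
    qed
    then show ?thesis by (simp only: S_def partial_sum_def)
  qed
  have B_mono: "B n \<le> B (Suc n)" for n
    unfolding B_def normalizer_def using a1 a2 monoD[OF mono_t(1), of n "Suc n"] monoD[OF mono_t(2), of n "Suc n"]
    by (auto intro!: powr_mono2)
  have a_mono: "eventually (\<lambda>n. B n * f (real n) powr (1 / \<alpha>) \<le> B (Suc n) * f (real (Suc n)) powr (1 / \<alpha>)) sequentially"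
    if "0 < \<alpha>" for \<alpha> :: real
    using g_f g_f[THEN eventually_sequentially_Suc[THEN iffD2]]
  proof eventually_elim
    case (elim n)
    have "g n powr (1 / \<alpha>) \<le> g (Suc n) powr (1 / \<alpha>)"
      using that g(2)[of n] monoD[OF g(1), of n "Suc n"] by (intro powr_mono2) auto
    moreover have "0 \<le> B (Suc n)" by (simp add: B_def normalizer_def)
    ultimately show ?case unfolding elim using B_mono[of n] by (intro mult_mono) auto
  qed
  have g_large: "filterlim g at_top sequentially" "eventually (\<lambda>n. ln (real n) \<le> g n) sequentially"
    if sum: "summable (\<lambda>k. 1 / (real k * g k))"
  proof -
    let ?N = "{1..} :: nat set"
    have N: "?N \<subseteq> {1..}" by simp
    have cntN: "cnt ?N n = n" for n by (simp add: cnt_def Int_absorb1)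
    have lim: "filterlim (cnt ?N) at_top sequentially" unfolding ext[of "cnt ?N" "\<lambda>n. n", OF cntN] by (rule filterlim_ident)
    note w = divergent_weight_at_top[OF N lim g summable_class_weights[OF N g sum]]
    show "filterlim g at_top sequentially" by (rule w(1))
    have "eventually (\<lambda>n. harm n / g n < 1) sequentially"
      using order_tendstoD(2)[OF w(2), of 1] by (simp only: cntN zero_less_one)
    then show "eventually (\<lambda>n. ln (real n) \<le> g n) sequentially"
      using eventually_ge_at_top[of 1]
    proof eventually_elim
      case (elim n)
      have "ln (real n) \<le> ln (real n + 1)" using elim by (intro ln_mono) auto
      also have "\<dots> \<le> harm n" by (rule harm_ge_ln)
      also have "\<dots> \<le> g n" using elim g(2)[of n] by (simp add: field_simps)
      finally show ?case .
    qed
  qed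

  show ?thesis
  proof (intro conjI impI)
    assume \<Lambda>: "0 < \<Lambda>"
    obtain c \<kappa> K where c: "0 < c" and \<kappa>: "0 < \<kappa>" and K: "0 < K"
      and bc: "eventually (\<lambda>n. c * real (\<tau>2 n) powr \<alpha>1 \<le> real (\<tau>1 n) powr \<alpha>2) sequentially"
      and b1: "eventually (\<lambda>n. \<kappa> * real (\<tau>1 n) powr (1 / \<alpha>1) \<le> B n) sequentially"
      and b2: "eventually (\<lambda>n. \<kappa> * real (\<tau>2 n) powr (1 / \<alpha>2) \<le> B n) sequentially"
      and bK: "eventually (\<lambda>n. B n \<le> K * real (\<tau>1 n) powr (1 / \<alpha>1)) sequentially"
      unfolding B_def using normalizer_asymptotics[OF a1(1) a2(1) inf1 inf2 assms(25) \<Lambda>] by blast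
    show "AE \<omega> in M.
        (limsup (\<lambda>n. ereal (\<bar>S n \<omega>\<bar> / (B n * f (real n) powr (1 / \<alpha>1)))) = 0 \<longleftrightarrow> ?I < \<infinity>) \<and>
        (limsup (\<lambda>n. ereal (\<bar>S n \<omega>\<bar> / (B n * f (real n) powr (1 / \<alpha>1)))) = \<infinity> \<longleftrightarrow> ?I = \<infinity>)"
    proof (rule zero_infinity_dichotomy)
      assume "?I < \<infinity>"
      then have sum: "summable (\<lambda>k. 1 / (real k * g k))" using I by simp
      show "AE \<omega> in M. limsup (\<lambda>n. ereal (\<bar>S n \<omega>\<bar> / (B n * f (real n) powr (1 / \<alpha>1)))) = 0"
      proof (rule conv_case[OF g sum sum \<kappa>])
        show "eventually (\<lambda>n. \<kappa> * (real (\<tau>1 n) * g n) powr (1 / \<alpha>1) \<le> B n * f (real n) powr (1 / \<alpha>1)) sequentially"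
          using g_f b1
        proof eventually_elim
          case (elim n)
          then show ?case
            using mult_right_mono[OF elim(2), of "g n powr (1 / \<alpha>1)"] g(2)[of n] by (simp add: powr_mult mult_ac)
        qed
        have "eventually (\<lambda>n. 1 \<le> g n) sequentially"
          using g_large(1)[OF sum] unfolding filterlim_at_top by blast
        with g_f b2
        show "eventually (\<lambda>n. \<kappa> * (real (\<tau>2 n) * g n) powr (1 / \<alpha>2) \<le> B n * f (real n) powr (1 / \<alpha>1)) sequentially"
        proof eventually_elim
          case (elim n)
          have "g n powr (1 / \<alpha>2) \<le> g n powr (1 / \<alpha>1)"
            using elim a1 a12 by (intro powr_mono) (auto simp: frac_le)
          moreover have "0 \<le> \<kappa> * real (\<tau>2 n) powr (1 / \<alpha>2)" using \<kappa> by simp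
          ultimately have "\<kappa> * real (\<tau>2 n) powr (1 / \<alpha>2) * g n powr (1 / \<alpha>2) \<le> B n * g n powr (1 / \<alpha>1)"
            using elim by (intro mult_mono) auto
          then show ?case using elim g(2)[of n] by (simp add: powr_mult mult_ac)
        qed
      qed
    next
      assume "\<not> ?I < \<infinity>"
      then have div: "\<not> summable (\<lambda>k. 1 / (real k * g k))" using I by simp
      show "AE \<omega> in M. limsup (\<lambda>n. ereal (\<bar>S n \<omega>\<bar> / (B n * f (real n) powr (1 / \<alpha>1)))) = \<infinity>"
      proof (rule div_case[OF tails(1) a1(1) _ _ _ _ div _ a_mono[OF a1(1)] K])
        show "filterlim (cnt ?T1) at_top sequentially" using inf1 by (simp only: t1)
        show "0 < \<alpha>1 / \<alpha>2" using a1 a2 by simp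
        show "0 < min 1 (c powr (1 / \<alpha>2)) * (1 / 2) powr (\<alpha>1 / \<alpha>2)" using c by simp
        show "eventually (\<lambda>n. min 1 (c powr (1 / \<alpha>2)) * (1 / 2) powr (\<alpha>1 / \<alpha>2) * real n powr (\<alpha>1 / \<alpha>2) \<le> real (cnt ?T1 n)) sequentially"
          unfolding t1[symmetric] using bc eventually_ge_at_top[of 2]
        proof eventually_elim
          case (elim n)
          show ?case
            by (rule count_power_lower_bound[OF a1(1) a12 c _ _ _ _ elim(1)]) (use elim(2) total[of n] in auto)
        qed
        show "eventually (\<lambda>n. 0 < B n * f (real n) powr (1 / \<alpha>1)) sequentially"
          using g_f b1 pos1
        proof eventually_elim
          case (elim n)
          have "0 < \<kappa> * real (\<tau>1 n) powr (1 / \<alpha>1)" using elim \<kappa> by simp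
          then have "0 < B n" using elim by linarith
          then show ?case using elim g(2)[of n] by simp
        qed
        show "eventually (\<lambda>n. B n * f (real n) powr (1 / \<alpha>1) \<le> K * (real (cnt ?T1 n) * g n) powr (1 / \<alpha>1)) sequentially"
          unfolding t1[symmetric] using g_f bK
        proof eventually_elim
          case (elim n)
          then show ?case
            using mult_right_mono[OF elim(2), of "g n powr (1 / \<alpha>1)"] g(2)[of n] by (simp add: powr_mult mult_ac)
        qed
      qed
    qed
  next
    assume "\<Lambda> = 0 \<and> (\<exists>\<mu> > (\<alpha>2 - \<alpha>1) / \<alpha>2. \<forall>\<^sub>F n in sequentially.
         real (\<tau>1 n) < real n powr (\<alpha>1 / \<alpha>2) * ln (real n) powr (- \<mu>))"
    then obtain \<mu> where \<Lambda>: "\<Lambda> = 0" and \<mu>: "(\<alpha>2 - \<alpha>1) / \<alpha>2 < \<mu>"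
      and rare: "\<forall>\<^sub>F n in sequentially. real (\<tau>1 n) < real n powr (\<alpha>1 / \<alpha>2) * ln (real n) powr (- \<mu>)" by blast
    have B: "B n = real (\<tau>2 n) powr (1 / \<alpha>2)" for n by (simp add: B_def normalizer_def \<Lambda>)
    have p: "0 < \<alpha>1 / \<alpha>2" "\<alpha>1 / \<alpha>2 < 1" using a1 a2 a12 by auto
    have \<mu>p: "1 < \<mu> + \<alpha>1 / \<alpha>2" using \<mu> a2 by (simp add: diff_divide_distrib)
    have \<mu>0: "0 < \<mu>" using \<mu>p p by linarith
    have half: "eventually (\<lambda>n. real n / 2 \<le> real (\<tau>2 n)) sequentially"
    proof -
      have "eventually (\<lambda>x::real. x powr (\<alpha>1 / \<alpha>2) * ln x powr (- \<mu>) \<le> x / 2) at_top"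
      proof -
        have "\<alpha>1 / \<alpha>2 - 1 < 0" using p by simp
        then have "((\<lambda>x::real. x powr (\<alpha>1 / \<alpha>2 - 1) * ln x powr (- \<mu>)) \<longlongrightarrow> 0) at_top" by real_asymp
        then have "eventually (\<lambda>x::real. x powr (\<alpha>1 / \<alpha>2 - 1) * ln x powr (- \<mu>) < 1 / 2) at_top"
          by (rule order_tendstoD(2)) simp
        then show ?thesis
          using eventually_gt_at_top[of 0]
        proof eventually_elim
          case (elim x)
          have "x powr (\<alpha>1 / \<alpha>2) * ln x powr (- \<mu>) = x * (x powr (\<alpha>1 / \<alpha>2 - 1) * ln x powr (- \<mu>))"
            using elim by (simp add: powr_diff)
          also have "\<dots> \<le> x * (1 / 2)" using elim by (intro mult_left_mono) auto
          finally show ?case by simp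
        qed
      qed
      from eventually_compose_filterlim[OF this filterlim_real_sequentially]
      show ?thesis using rare
      proof eventually_elim
        case (elim n)
        then show ?case using total[of n] by linarith
      qed
    qed
    show "AE \<omega> in M.
        (limsup (\<lambda>n. ereal (\<bar>S n \<omega>\<bar> / (B n * f (real n) powr (1 / \<alpha>2)))) = 0 \<longleftrightarrow> ?I < \<infinity>) \<and>
        (limsup (\<lambda>n. ereal (\<bar>S n \<omega>\<bar> / (B n * f (real n) powr (1 / \<alpha>2)))) = \<infinity> \<longleftrightarrow> ?I = \<infinity>)"
    proof (rule zero_infinity_dichotomy)
      assume "?I < \<infinity>"
      then have sum: "summable (\<lambda>k. 1 / (real k * g k))" using I by simp
      \<comment> \<open>The total exponent is \<open>\<mu> + \<alpha>1 / \<alpha>2 > 1\<close>: the part \<open>\<mu>\<close> is paid for by the sparsity of the first class,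
        the part \<open>\<alpha>1 / \<alpha>2\<close> by \<open>ln n \<le> g n\<close>.\<close>
      define h where "h n = (1 + ln (real (max 1 n))) powr (1 + (\<mu> + \<alpha>1 / \<alpha>2 - 1))" for n :: nat
      have h: "mono h" "\<And>n. 0 < h n" "summable (\<lambda>k. 1 / (real k * h k))"
      proof -
        show "mono h" unfolding h_def using \<mu>p by (intro monoI powr_mono2 add_left_mono ln_mono) auto
        show "0 < h n" for n
          unfolding h_def by (simp add: add_pos_nonneg less_imp_neq[symmetric])
        show "summable (\<lambda>k. 1 / (real k * h k))"
          unfolding h_def using \<mu>p by (intro summable_inverse_mult_ln_powr) simp
      qed
      \<comment> \<open>The factors \<open>2\<close> come from \<open>1 + ln n \<le> 2 * ln n\<close> and from \<open>n \<le> 2 * \<tau>2 n\<close>.\<close>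
      define \<kappa> where "\<kappa> = (1 / (2 powr (\<mu> + \<alpha>1 / \<alpha>2) * 2 powr (\<alpha>1 / \<alpha>2))) powr (1 / \<alpha>1)"
      have \<kappa>: "0 < min 1 \<kappa>" by (simp add: \<kappa>_def)
      show "AE \<omega> in M. limsup (\<lambda>n. ereal (\<bar>S n \<omega>\<bar> / (B n * f (real n) powr (1 / \<alpha>2)))) = 0"
      proof (rule conv_case[OF h sum \<kappa>])
        show "eventually (\<lambda>n. min 1 \<kappa> * (real (\<tau>2 n) * g n) powr (1 / \<alpha>2) \<le> B n * f (real n) powr (1 / \<alpha>2)) sequentially"
          using g_f
        proof eventually_elim
          case (elim n)
          have "B n * f (real n) powr (1 / \<alpha>2) = (real (\<tau>2 n) * g n) powr (1 / \<alpha>2)"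
            unfolding elim B using g(2)[of n] by (simp add: powr_mult)
          then show ?case using \<kappa> by (simp add: mult_left_le_one_le)
        qed
        show "eventually (\<lambda>n. min 1 \<kappa> * (real (\<tau>1 n) * h n) powr (1 / \<alpha>1) \<le> B n * f (real n) powr (1 / \<alpha>2)) sequentially"
          \<comment> \<open>From \<open>n = 3\<close> on, \<open>ln n \<ge> 1\<close>.\<close>
          using g_f rare half g_large(2)[OF sum] eventually_ge_at_top[of 3]
        proof eventually_elim
          case (elim n)
          let ?p = "\<alpha>1 / \<alpha>2" and ?l = "ln (real n)"
          have l: "1 \<le> ?l"
          proof -
            have "exp 1 \<le> real n" using exp_le elim(5) by linarith
            then show ?thesis using elim(5) by (simp add: ln_ge_iff)
          qed
          have h_le: "h n \<le> 2 powr (\<mu> + ?p) * ?l powr (\<mu> + ?p)"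
          proof -
            have "h n = (1 + ?l) powr (\<mu> + ?p)" using elim(5) by (simp add: h_def max_def)
            also have "\<dots> \<le> (2 * ?l) powr (\<mu> + ?p)" using l \<mu>p by (intro powr_mono2) auto
            finally show ?thesis using l by (simp add: powr_mult)
          qed
          have "real (\<tau>1 n) * h n \<le> (real n powr ?p * ?l powr (- \<mu>)) * (2 powr (\<mu> + ?p) * ?l powr (\<mu> + ?p))"
            using elim(2) h_le h(2)[of n] by (intro mult_mono) auto
          also have "\<dots> = 2 powr (\<mu> + ?p) * (real n * ?l) powr ?p"
            using l elim(5) by (simp add: powr_mult powr_add powr_minus field_simps)
          also have "\<dots> \<le> 2 powr (\<mu> + ?p) * (2 * (real (\<tau>2 n) * g n)) powr ?p"
          proof (intro mult_left_mono powr_mono2)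
            have "real n * ?l \<le> (2 * real (\<tau>2 n)) * g n" using elim l by (intro mult_mono) auto
            then show "real n * ?l \<le> 2 * (real (\<tau>2 n) * g n)" by simp
          qed (use p l in auto)
          also have "\<dots> = (2 powr (\<mu> + ?p) * 2 powr ?p) * (real (\<tau>2 n) * g n) powr ?p"
            using g(2)[of n] by (simp add: powr_mult)
          finally have "1 / (2 powr (\<mu> + ?p) * 2 powr ?p) * (real (\<tau>1 n) * h n) \<le> (real (\<tau>2 n) * g n) powr ?p"
            by (simp add: field_simps)
          then have "(1 / (2 powr (\<mu> + ?p) * 2 powr ?p) * (real (\<tau>1 n) * h n)) powr (1 / \<alpha>1)
              \<le> ((real (\<tau>2 n) * g n) powr ?p) powr (1 / \<alpha>1)"
            using a1 h(2)[of n] by (intro powr_mono2) auto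
          also have "((real (\<tau>2 n) * g n) powr ?p) powr (1 / \<alpha>1) = (real (\<tau>2 n) * g n) powr (1 / \<alpha>2)"
            using a1 by (simp add: powr_powr)
          also have "(1 / (2 powr (\<mu> + ?p) * 2 powr ?p) * (real (\<tau>1 n) * h n)) powr (1 / \<alpha>1)
              = \<kappa> * (real (\<tau>1 n) * h n) powr (1 / \<alpha>1)"
            unfolding \<kappa>_def by (rule powr_mult)
          finally have "\<kappa> * (real (\<tau>1 n) * h n) powr (1 / \<alpha>1) \<le> B n * f (real n) powr (1 / \<alpha>2)"
            using g(2)[of n] by (simp add: elim(1) B powr_mult)
          moreover have "min 1 \<kappa> * (real (\<tau>1 n) * h n) powr (1 / \<alpha>1) \<le> \<kappa> * (real (\<tau>1 n) * h n) powr (1 / \<alpha>1)"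
            by (intro mult_right_mono) auto
          ultimately show ?case by linarith
        qed
      qed
    next
      assume "\<not> ?I < \<infinity>"
      then have div: "\<not> summable (\<lambda>k. 1 / (real k * g k))" using I by simp
      show "AE \<omega> in M. limsup (\<lambda>n. ereal (\<bar>S n \<omega>\<bar> / (B n * f (real n) powr (1 / \<alpha>2)))) = \<infinity>"
      proof -
        have inf2': "filterlim (cnt ?T2) at_top sequentially" using inf2 by (simp only: t2)
        have dense: "eventually (\<lambda>n. 1 / 2 * real n powr 1 \<le> real (cnt ?T2 n)) sequentially"
          unfolding t2[symmetric] using half by eventually_elim simp
        have pos: "eventually (\<lambda>n. 0 < B n * f (real n) powr (1 / \<alpha>2)) sequentially"
          using g_f pos2
        proof eventually_elim
          case (elim n)
          then show ?case using g(2)[of n] by (simp add: B)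
        qed
        have le: "eventually (\<lambda>n. B n * f (real n) powr (1 / \<alpha>2) \<le> 1 * (real (cnt ?T2 n) * g n) powr (1 / \<alpha>2)) sequentially"
          unfolding t2[symmetric] using g_f
        proof eventually_elim
          case (elim n)
          then show ?case using g(2)[of n] by (simp add: B powr_mult)
        qed
        show ?thesis
          by (rule div_case[OF tails(2) a2(1) inf2' zero_less_one _ dense div pos a_mono[OF a2(1)] zero_less_one le]) simp
      qed
    qed
  qed
qed

end
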